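(* Let $n \geq 5$ be an integer. Then the Specht module $\mathcal{S}^{(2^2,1^{n-4})}$ of $S_n$ is unisingular if and only if $n$ is even.
   Context: A finite-dimensional representation $\rho: G \to \mathrm{GL}(V)$ of a finite group $G$ is called unisingular if $\det(1-\rho(g)) = 0$ for all $g \in G$, i.e. every $\rho(g)$ has $1$ as an eigenvalue. For a partition $\lambda \vdash n$, $\mathcal{S}^\lambda$ denotes the Specht module: the irreducible complex representation of the symmetric group $S_n$ indexed by $\lambda$, with the standard convention that $\mathcal{S}^{(n)}$ is the trivial representation and $\mathcal{S}^{(1^n)}$ is the sign representation. The partition $(2^2,1^{n-4})$ is $(2,2,1,\dots,1)$ with $n-4$ ones; it is the conjugate of $(n-2,2)$. *)

theory Defs
  imports
    "Jordan_Normal_Form.Determinant"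
    "HOL-Algebra.Sym_Groups"
    "HOL-Library.Function_Algebras"
begin

section \<open>Determinants of endomorphisms of a finite-dimensional subspace\<close>

text \<open>
  A separate locale, because definitions added to \<open>vector_space\<close> itself would be shadowed by
  their instances for the unqualified interpretation \<open>real_vector\<close>.
\<close>
locale vector_space_endo = vector_space scale
  for scale :: "'a :: field \<Rightarrow> 'b :: ab_group_add \<Rightarrow> 'b"
begin

definition is_ordered_basis :: "'b list \<Rightarrow> 'b set \<Rightarrow> bool" where
  "is_ordered_basis bs V \<longleftrightarrow> distinct bs \<and> independent (set bs) \<and> span (set bs) = V"

definition endo_matrix :: "'b list \<Rightarrow> ('b \<Rightarrow> 'b) \<Rightarrow> 'a mat" where
  "endo_matrix bs f =
     mat (length bs) (length bs) (\<lambda>(i, j). representation (set bs) (f (bs ! j)) (bs ! i))"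

text \<open>
  The value is only meaningful if \<open>V\<close> is a finite-dimensional subspace and \<open>f\<close> restricts to
  a linear map from \<open>V\<close> to \<open>V\<close>; it then does not depend on the chosen basis.
\<close>
definition endo_det :: "'b set \<Rightarrow> ('b \<Rightarrow> 'b) \<Rightarrow> 'a" where
  "endo_det V f = det (endo_matrix (SOME bs. is_ordered_basis bs V) f)"

definition linear_endo_on :: "'b set \<Rightarrow> ('b \<Rightarrow> 'b) \<Rightarrow> bool" where
  "linear_endo_on V f \<longleftrightarrow> f ` V \<subseteq> V \<and> (\<forall>x\<in>V. \<forall>y\<in>V. f (x + y) = f x + f y)
     \<and> (\<forall>c. \<forall>x\<in>V. f (scale c x) = scale c (f x))"

lemma exists_ordered_basis:
  assumes "finite S" "span S = V"
  shows "\<exists>bs. is_ordered_basis bs V"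
proof -
  obtain B where B: "B \<subseteq> S" "independent B" "S \<subseteq> span B"
    using maximal_independent_subset[of S] by blast
  have "finite B" using B(1) assms(1) finite_subset by blast
  then obtain bs where bs: "set bs = B" "distinct bs" using finite_distinct_list by blast
  have "span B = V"
  proof
    show "span B \<subseteq> V" using span_mono[OF B(1)] assms(2) by simp
    show "V \<subseteq> span B" using span_minimal[OF B(3) subspace_span] assms(2) by simp
  qed
  with bs B(2) show ?thesis unfolding is_ordered_basis_def by auto
qed

lemma endo_det_eq_0_iff:
  assumes fin: "finite S" "span S = V" and f: "linear_endo_on V f"
  shows "endo_det V f = 0 \<longleftrightarrow> (\<exists>v\<in>V. v \<noteq> 0 \<and> f v = 0)"
proof -
  define bs where "bs = (SOME bs. is_ordered_basis bs V)"
  have "is_ordered_basis bs V"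
    unfolding bs_def using exists_ordered_basis[OF fin] by (rule someI_ex)
  hence dis: "distinct bs" and ind: "independent (set bs)" and sp: "span (set bs) = V"
    unfolding is_ordered_basis_def by auto
  define d where "d = length bs"
  define A where "A = endo_matrix bs f"
  define L where "L = (\<lambda>x. \<Sum>j<d. scale (x $ j) (bs ! j))"
  have A: "A \<in> carrier_mat d d" unfolding A_def endo_matrix_def d_def by simp
  have subV: "subspace V" using sp subspace_span by blast
  have bV: "bs ! j \<in> V" if "j < d" for j
    using that sp span_base[of "bs ! j" "set bs"] unfolding d_def by auto
  have fV: "f v \<in> V" if "v \<in> V" for v
    using f that unfolding linear_endo_on_def by blast
  have reix: "(\<Sum>b\<in>set bs. g b) = (\<Sum>j<d. g (bs ! j))" for g :: "'b \<Rightarrow> 'b"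
    using sum.reindex_bij_betw[OF bij_betw_nth[OF dis refl refl], of g]
    unfolding d_def by simp
  have expand: "(\<Sum>i<d. scale (representation (set bs) v (bs ! i)) (bs ! i)) = v"
    if "v \<in> V" for v
    using sum_representation_eq[OF ind, of v "set bs"] that sp reix by auto
  have f0: "f 0 = 0"
  proof -
    have "f (scale 0 0) = scale 0 (f 0)"
      using f subspace_0[OF subV] unfolding linear_endo_on_def by blast
    thus ?thesis by simp
  qed
  have fsum: "f (\<Sum>j\<in>J. scale (x j) (bs ! j)) = (\<Sum>j\<in>J. scale (x j) (f (bs ! j)))"
    if "J \<subseteq> {..<d}" for x J
  proof -
    have "finite J" using that finite_subset by blast
    thus ?thesis using that
    proof (induction J rule: finite_induct)
      case empty
      show ?case by (simp add: f0)
    next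
      case (insert j J)
      have j: "bs ! j \<in> V" using insert bV by auto
      have "(\<Sum>j\<in>J. scale (x j) (bs ! j)) \<in> V"
        using insert bV by (intro subspace_sum[OF subV] subspace_scale[OF subV]) auto
      moreover have "scale (x j) (bs ! j) \<in> V" using subspace_scale[OF subV j] .
      ultimately have "f (scale (x j) (bs ! j) + (\<Sum>j\<in>J. scale (x j) (bs ! j)))
         = scale (x j) (f (bs ! j)) + f (\<Sum>j\<in>J. scale (x j) (bs ! j))"
        using f j unfolding linear_endo_on_def by metis
      thus ?case using insert by simp
    qed
  qed
  have LV: "L x \<in> V" for x
    unfolding L_def using bV by (intro subspace_sum[OF subV] subspace_scale[OF subV]) auto
  have key: "f (L x) = L (A *\<^sub>v x)" if x: "x \<in> carrier_vec d" for x
  proof -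
    have "f (L x) = (\<Sum>j<d. scale (x $ j) (f (bs ! j)))"
      unfolding L_def by (rule fsum) simp
    also have "\<dots> = (\<Sum>j<d. scale (x $ j)
        (\<Sum>i<d. scale (representation (set bs) (f (bs ! j)) (bs ! i)) (bs ! i)))"
      using expand fV bV by (intro sum.cong refl) simp
    also have "\<dots> = (\<Sum>j<d. \<Sum>i<d. scale (A $$ (i, j) * x $ j) (bs ! i))"
      unfolding scale_sum_right A_def endo_matrix_def
      by (intro sum.cong refl) (auto simp: d_def mult.commute)
    also have "\<dots> = (\<Sum>i<d. \<Sum>j<d. scale (A $$ (i, j) * x $ j) (bs ! i))"
      by (rule sum.swap)
    also have "\<dots> = (\<Sum>i<d. scale ((A *\<^sub>v x) $ i) (bs ! i))"
      using A x by (intro sum.cong refl)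
        (auto simp: scale_sum_left[symmetric] scalar_prod_def lessThan_atLeast0)
    finally show ?thesis unfolding L_def .
  qed
  have L0: "L x = 0 \<longleftrightarrow> x = 0\<^sub>v d" if x: "x \<in> carrier_vec d" for x
  proof
    assume "L x = 0"
    obtain ix where ix: "\<And>j. j < d \<Longrightarrow> ix (bs ! j) = j"
      using bij_betw_nth[OF dis refl refl] unfolding bij_betw_def d_def
      by (metis (no_types, lifting) inv_into_f_f lessThan_iff)
    have "(\<Sum>b\<in>set bs. scale (x $ ix b) b) = 0"
      using \<open>L x = 0\<close> ix unfolding reix L_def by simp
    hence "x $ ix b = 0" if "b \<in> set bs" for b
      using independentD[OF ind finite_set subset_refl, of "\<lambda>b. x $ ix b"] that by simp
    hence "x $ j = 0" if "j < d" for j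
      using that ix[OF that] unfolding d_def by (metis nth_mem)
    thus "x = 0\<^sub>v d" using x by (intro eq_vecI) auto
  qed (simp add: L_def)
  have surj: "\<exists>x\<in>carrier_vec d. L x = v" if "v \<in> V" for v
    using expand[OF that]
    by (intro bexI[of _ "vec d (\<lambda>i. representation (set bs) v (bs ! i))"])
       (auto simp: L_def)
  have "endo_det V f = 0 \<longleftrightarrow>
     (\<exists>x. x \<in> carrier_vec d \<and> x \<noteq> 0\<^sub>v d \<and> A *\<^sub>v x = 0\<^sub>v d)"
    using det_0_iff_vec_prod_zero_field[OF A] unfolding endo_det_def A_def bs_def .
  also have "\<dots> \<longleftrightarrow> (\<exists>x. x \<in> carrier_vec d \<and> L x \<noteq> 0 \<and> f (L x) = 0)"
    using L0 key A by (metis mult_mat_vec_carrier)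
  also have "\<dots> \<longleftrightarrow> (\<exists>v\<in>V. v \<noteq> 0 \<and> f v = 0)"
    using LV surj by metis
  finally show ?thesis .
qed

end


section \<open>Complex representations and unisingularity\<close>

text \<open>
  Complex representations are realised on finite-dimensional subspaces \<open>V\<close> of a space of
  complex-valued functions; \<open>\<rho> g\<close> is a map on the ambient space of which only the restriction
  to \<open>V\<close> matters.
\<close>

global_interpretation cfun: vector_space_endo "\<lambda>(c :: complex) (f :: 'a \<Rightarrow> complex) x. c * f x"
  by unfold_locales (auto simp: fun_eq_iff algebra_simps)

definition finite_dim_representation ::
  "('g, 'm) monoid_scheme \<Rightarrow> ('a \<Rightarrow> complex) set \<Rightarrow>
     ('g \<Rightarrow> ('a \<Rightarrow> complex) \<Rightarrow> ('a \<Rightarrow> complex)) \<Rightarrow> bool" where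
  "finite_dim_representation G V \<rho> \<longleftrightarrow>
     (\<exists>S. finite S \<and> cfun.span S = V) \<and>
     (\<forall>g\<in>carrier G. cfun.linear_endo_on V (\<rho> g)) \<and>
     (\<forall>v\<in>V. \<rho> \<one>\<^bsub>G\<^esub> v = v) \<and>
     (\<forall>g\<in>carrier G. \<forall>h\<in>carrier G. \<forall>v\<in>V. \<rho> (g \<otimes>\<^bsub>G\<^esub> h) v = \<rho> g (\<rho> h v))"

definition unisingular ::
  "('g, 'm) monoid_scheme \<Rightarrow> ('a \<Rightarrow> complex) set \<Rightarrow>
     ('g \<Rightarrow> ('a \<Rightarrow> complex) \<Rightarrow> ('a \<Rightarrow> complex)) \<Rightarrow> bool" where
  "unisingular G V \<rho> \<longleftrightarrow> (\<forall>g\<in>carrier G. cfun.endo_det V (\<lambda>v. v - \<rho> g v) = 0)"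

lemma unisingular_iff_eigenvalue_1:
  assumes "finite_dim_representation G V \<rho>"
  shows "unisingular G V \<rho> \<longleftrightarrow> (\<forall>g\<in>carrier G. \<exists>v\<in>V. v \<noteq> 0 \<and> \<rho> g v = v)"
proof -
  obtain S where S: "finite S" "cfun.span S = V"
    using assms unfolding finite_dim_representation_def by blast
  have sub: "cfun.subspace V" using S(2) cfun.subspace_span by blast
  have "cfun.endo_det V (\<lambda>v. v - \<rho> g v) = 0 \<longleftrightarrow> (\<exists>v\<in>V. v \<noteq> 0 \<and> \<rho> g v = v)"
    if g: "g \<in> carrier G" for g
  proof -
    have l: "cfun.linear_endo_on V (\<rho> g)"
      using assms g unfolding finite_dim_representation_def by blast
    have "cfun.linear_endo_on V (\<lambda>v. v - \<rho> g v)"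
      unfolding cfun.linear_endo_on_def
    proof (intro conjI allI ballI)
      show "(\<lambda>v. v - \<rho> g v) ` V \<subseteq> V"
        using l cfun.subspace_diff[OF sub] unfolding cfun.linear_endo_on_def by blast
      fix x assume x: "x \<in> V"
      show "x + y - \<rho> g (x + y) = x - \<rho> g x + (y - \<rho> g y)" if "y \<in> V" for y
        using l x that unfolding cfun.linear_endo_on_def by simp
      show "(\<lambda>z. c * x z) - \<rho> g (\<lambda>z. c * x z) = (\<lambda>z. c * (x - \<rho> g x) z)" for c
        using l x unfolding cfun.linear_endo_on_def
        by (simp add: fun_eq_iff right_diff_distrib)
    qed
    moreover have "v - \<rho> g v = 0 \<longleftrightarrow> \<rho> g v = v" for v
      unfolding right_minus_eq by (rule eq_commute)
    ultimately show ?thesis using cfun.endo_det_eq_0_iff[OF S] by simp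
  qed
  thus ?thesis unfolding unisingular_def by blast
qed


section \<open>Specht modules\<close>

text \<open>
  A partition is a weakly decreasing list of positive parts; boxes \<open>(i, j)\<close> of its diagram are
  given by row and column, both counted from 0. A tableau of shape \<open>\<mu>\<close> is a bijective filling
  of the diagram with \<open>1, \<dots>, n\<close>, where \<open>n\<close> is the size of \<open>\<mu>\<close>; its values off the diagram
  are irrelevant.
\<close>

definition young_diagram :: "nat list \<Rightarrow> (nat \<times> nat) set" where
  "young_diagram \<mu> = {(i, j). i < length \<mu> \<and> j < \<mu> ! i}"

definition young_tableaux :: "nat list \<Rightarrow> (nat \<times> nat \<Rightarrow> nat) set" where
  "young_tableaux \<mu> = {t. bij_betw t (young_diagram \<mu>) {1..sum_list \<mu>}}"

definition tableau_row :: "nat list \<Rightarrow> (nat \<times> nat \<Rightarrow> nat) \<Rightarrow> nat \<Rightarrow> nat set" where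
  "tableau_row \<mu> t i = {t (i, j) | j. (i, j) \<in> young_diagram \<mu>}"

definition tableau_column :: "nat list \<Rightarrow> (nat \<times> nat \<Rightarrow> nat) \<Rightarrow> nat \<Rightarrow> nat set" where
  "tableau_column \<mu> t j = {t (i, j) | i. (i, j) \<in> young_diagram \<mu>}"

text \<open>
  Tabloids are classes of tableaux with the same row sets, so the class of \<open>t\<close> is encoded as
  the list of its row sets.
\<close>

definition tabloid :: "nat list \<Rightarrow> (nat \<times> nat \<Rightarrow> nat) \<Rightarrow> nat set list" where
  "tabloid \<mu> t = map (tableau_row \<mu> t) [0..<length \<mu>]"

definition column_stabilizer :: "nat list \<Rightarrow> (nat \<times> nat \<Rightarrow> nat) \<Rightarrow> (nat \<Rightarrow> nat) set" where
  "column_stabilizer \<mu> t =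
     {p \<in> carrier (sym_group (sum_list \<mu>)).
        \<forall>j. p ` tableau_column \<mu> t j = tableau_column \<mu> t j}"

text \<open>
  The polytabloid \<open>\<Sum>p. sign p \<cdot> {p t}\<close>, summed over the column stabilizer of \<open>t\<close>, as the
  function giving the coefficient of each tabloid.
\<close>
definition polytabloid ::
  "nat list \<Rightarrow> (nat \<times> nat \<Rightarrow> nat) \<Rightarrow> nat set list \<Rightarrow> complex" where
  "polytabloid \<mu> t =
     (\<lambda>T. \<Sum>p\<in>column_stabilizer \<mu> t. if tabloid \<mu> (p \<circ> t) = T then of_int (sign p) else 0)"

text \<open>
  With this convention the Specht module of \<open>[n]\<close> is the trivial representation and that of
  \<open>replicate n 1\<close> is the sign representation.
\<close>
definition specht :: "nat list \<Rightarrow> (nat set list \<Rightarrow> complex) set" where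
  "specht \<mu> = cfun.span (polytabloid \<mu> ` young_tableaux \<mu>)"

text \<open>
  The linear extension of the action of permutations on the entries of tabloids. In terms of
  coefficient functions it is precomposition with the inverse permutation.
\<close>
definition tabloid_rep ::
  "(nat \<Rightarrow> nat) \<Rightarrow> (nat set list \<Rightarrow> complex) \<Rightarrow> (nat set list \<Rightarrow> complex)" where
  "tabloid_rep p v = (\<lambda>T. v (map ((`) (inv' p)) T))"

lemma tableau_row_comp: "tableau_row \<mu> (p \<circ> t) i = p ` tableau_row \<mu> t i"
  unfolding tableau_row_def by auto

lemma tableau_column_comp: "tableau_column \<mu> (p \<circ> t) j = p ` tableau_column \<mu> t j"
  unfolding tableau_column_def by auto

lemma tabloid_comp: "tabloid \<mu> (p \<circ> t) = map ((`) p) (tabloid \<mu> t)"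
  unfolding tabloid_def by (simp add: tableau_row_comp)

lemma tabloid_rep_polytabloid:
  assumes p: "p permutes {1..sum_list \<mu>}"
  shows "tabloid_rep p (polytabloid \<mu> t) = polytabloid \<mu> (p \<circ> t)"
proof
  fix T
  let ?q = "inv' p"
  note q = permutes_inv[OF p]
  have pq: "p \<circ> ?q = id" "?q \<circ> p = id" using permutes_inv_o[OF p] by auto
  have map_pq: "map ((`) p) (map ((`) ?q) U) = U" "map ((`) ?q) (map ((`) p) U) = U"
    for U :: "nat set list"
    using pq by (simp_all add: image_comp map_idI)
  have perm: "permutation p" "permutation ?q"
    using p q by (auto simp: permutation_permutes)
  have conj: "p \<circ> s \<circ> ?q \<in> column_stabilizer \<mu> (p \<circ> t)"
    if "s \<in> column_stabilizer \<mu> t" for s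
  proof -
    have s: "s permutes {1..sum_list \<mu>}"
      "\<And>j. s ` tableau_column \<mu> t j = tableau_column \<mu> t j"
      using that unfolding column_stabilizer_def sym_group_carrier by auto
    have "p \<circ> s \<circ> ?q permutes {1..sum_list \<mu>}"
      using permutes_compose[OF q permutes_compose[OF s(1) p]] .
    moreover have "(p \<circ> s \<circ> ?q) ` p ` C = p ` s ` C" for C
      using pq by (metis comp_id fun.map_comp image_comp)
    ultimately show ?thesis
      unfolding column_stabilizer_def sym_group_carrier tableau_column_comp using s(2) by simp
  qed
  have conj': "?q \<circ> s \<circ> p \<in> column_stabilizer \<mu> t"
    if "s \<in> column_stabilizer \<mu> (p \<circ> t)" for s
  proof -
    have s: "s permutes {1..sum_list \<mu>}"
      "\<And>j. s ` p ` tableau_column \<mu> t j = p ` tableau_column \<mu> t j"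
      using that unfolding column_stabilizer_def sym_group_carrier tableau_column_comp by auto
    have "?q \<circ> s \<circ> p permutes {1..sum_list \<mu>}"
      using permutes_compose[OF p permutes_compose[OF s(1) q]] .
    moreover have "(?q \<circ> s \<circ> p) ` tableau_column \<mu> t j = tableau_column \<mu> t j" for j
      using s(2)[of j] pq(2) by (metis image_comp image_id id_apply)
    ultimately show ?thesis
      unfolding column_stabilizer_def sym_group_carrier by simp
  qed
  show "tabloid_rep p (polytabloid \<mu> t) T = polytabloid \<mu> (p \<circ> t) T"
    unfolding tabloid_rep_def polytabloid_def
  proof (rule sum.reindex_bij_witness[where j = "\<lambda>s. p \<circ> s \<circ> ?q" and i = "\<lambda>s. ?q \<circ> s \<circ> p"])
    fix s assume s: "s \<in> column_stabilizer \<mu> t"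
    show "?q \<circ> (p \<circ> s \<circ> ?q) \<circ> p = s" using pq by (metis comp_assoc comp_id id_comp)
    show "p \<circ> s \<circ> ?q \<in> column_stabilizer \<mu> (p \<circ> t)" by (rule conj[OF s])
    have "permutation s"
      using s unfolding column_stabilizer_def by (auto dest: sym_group_carrier')
    hence sg: "sign (p \<circ> s \<circ> ?q) = sign s"
      using perm by (simp add: sign_compose permutation_compose sign_inverse)
    have "p \<circ> s \<circ> ?q \<circ> (p \<circ> t) = p \<circ> (s \<circ> t)" using pq by (metis comp_assoc comp_id)
    hence "tabloid \<mu> (p \<circ> s \<circ> ?q \<circ> (p \<circ> t)) = map ((`) p) (tabloid \<mu> (s \<circ> t))"
      by (simp only: tabloid_comp)
    hence "tabloid \<mu> (p \<circ> s \<circ> ?q \<circ> (p \<circ> t)) = T \<longleftrightarrow>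
        tabloid \<mu> (s \<circ> t) = map ((`) ?q) T"
      using map_pq by metis
    thus "(if tabloid \<mu> (p \<circ> s \<circ> ?q \<circ> (p \<circ> t)) = T
             then complex_of_int (sign (p \<circ> s \<circ> ?q)) else 0) =
          (if tabloid \<mu> (s \<circ> t) = map ((`) ?q) T then of_int (sign s) else 0)"
      using sg by simp
  next
    fix s assume s: "s \<in> column_stabilizer \<mu> (p \<circ> t)"
    show "p \<circ> (?q \<circ> s \<circ> p) \<circ> ?q = s" using pq by (metis comp_assoc comp_id id_comp)
    show "?q \<circ> s \<circ> p \<in> column_stabilizer \<mu> t" by (rule conj'[OF s])
  qed
qed

lemma finite_polytabloids: "finite (polytabloid \<mu> ` young_tableaux \<mu>)"
proof -
  let ?D = "young_diagram \<mu>"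
  have "?D = (SIGMA i:{..<length \<mu>}. {..<\<mu> ! i})" unfolding young_diagram_def by auto
  hence fin: "finite (PiE ?D (\<lambda>_. {1..sum_list \<mu>}))" by (intro finite_PiE) auto
  have row: "tableau_row \<mu> (p \<circ> restrict t ?D) i = tableau_row \<mu> (p \<circ> t) i" for p t i
    unfolding tableau_row_def by (rule Collect_cong) (metis comp_apply restrict_apply')
  have col: "tableau_column \<mu> (restrict t ?D) j = tableau_column \<mu> t j" for t j
    unfolding tableau_column_def by (rule Collect_cong) (metis restrict_apply')
  have "polytabloid \<mu> (restrict t ?D) = polytabloid \<mu> t" for t
    unfolding polytabloid_def tabloid_def column_stabilizer_def row col by (rule refl)
  moreover have "restrict t ?D \<in> PiE ?D (\<lambda>_. {1..sum_list \<mu>})"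
    if "t \<in> young_tableaux \<mu>" for t
    using that unfolding young_tableaux_def bij_betw_def by auto
  ultimately have "polytabloid \<mu> t \<in> polytabloid \<mu> ` PiE ?D (\<lambda>_. {1..sum_list \<mu>})"
    if "t \<in> young_tableaux \<mu>" for t
    using that by (intro image_eqI[of _ _ "restrict t ?D"]) simp_all
  hence "polytabloid \<mu> ` young_tableaux \<mu>
      \<subseteq> polytabloid \<mu> ` PiE ?D (\<lambda>_. {1..sum_list \<mu>})"
    by (rule image_subsetI)
  thus ?thesis by (rule finite_subset) (rule finite_imageI[OF fin])
qed

lemma specht_representation:
  assumes "sum_list \<mu> = n"
  shows "finite_dim_representation (sym_group n) (specht \<mu>) tabloid_rep"
proof -
  have add: "tabloid_rep p (x + y) = tabloid_rep p x + tabloid_rep p y" for p x y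
    unfolding tabloid_rep_def by auto
  have scl: "tabloid_rep p (\<lambda>z. c * x z) = (\<lambda>z. c * tabloid_rep p x z)" for p c x
    unfolding tabloid_rep_def by auto
  have into: "tabloid_rep p v \<in> specht \<mu>"
    if p: "p permutes {1..sum_list \<mu>}" and v: "v \<in> specht \<mu>" for p v
    using v unfolding specht_def
  proof (induction rule: cfun.span_induct_alt)
    case base
    have "tabloid_rep p 0 = 0" unfolding tabloid_rep_def by auto
    thus ?case by (simp only: cfun.span_zero)
  next
    case (step c x y)
    then obtain t where t: "t \<in> young_tableaux \<mu>" "x = polytabloid \<mu> t" by blast
    have "p \<circ> t \<in> young_tableaux \<mu>"
      using t(1) bij_betw_trans[OF _ permutes_imp_bij[OF p]] unfolding young_tableaux_def by blast
    hence "tabloid_rep p x \<in> cfun.span (polytabloid \<mu> ` young_tableaux \<mu>)"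
      unfolding t(2) tabloid_rep_polytabloid[OF p] by (intro cfun.span_base) blast
    thus ?case
      unfolding add scl using step by (intro cfun.span_add cfun.span_scale)
  qed
  show ?thesis
    unfolding finite_dim_representation_def
  proof (intro conjI ballI)
    show "\<exists>S. finite S \<and> cfun.span S = specht \<mu>"
      unfolding specht_def using finite_polytabloids by blast
    show "cfun.linear_endo_on (specht \<mu>) (tabloid_rep g)" if "g \<in> carrier (sym_group n)" for g
      unfolding cfun.linear_endo_on_def
      using add scl into that assms sym_group_carrier by blast
    show "tabloid_rep \<one>\<^bsub>sym_group n\<^esub> v = v" for v
      unfolding tabloid_rep_def sym_group_one by simp
    show "tabloid_rep (g \<otimes>\<^bsub>sym_group n\<^esub> h) v = tabloid_rep g (tabloid_rep h v)"
      if "g \<in> carrier (sym_group n)" "h \<in> carrier (sym_group n)" for g h v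
    proof -
      have "bij g" "bij h" using that unfolding sym_group_carrier by (auto intro: permutes_bij)
      hence "inv' (g \<circ> h) = inv' h \<circ> inv' g" by (rule o_inv_distrib)
      thus ?thesis unfolding tabloid_rep_def sym_group_mult by (simp add: image_comp comp_def)
    qed
  qed
qed

end

theory Submission
  imports Defs "HOL-Combinatorics.Orbits"
begin

text \<open>
  A polytabloid of shape \<open>(2\<^sup>2, 1\<^sup>n\<^sup>-\<^sup>4)\<close> is determined up to sign by the pair
  \<open>Q\<close> of entries in the second column, so the Specht module is the image of the sign-twisted
  space of functions \<open>F\<close> on pairs. Evaluated at a tabloid whose rows of length 2 are
  \<open>{p, q}\<close> and \<open>{r, s}\<close>, the image of \<open>F\<close> is
  \<open>\<plusminus>(F {p, r} - F {p, s} - F {q, r} + F {q, s})\<close>. Averaging over the powers of \<open>g\<close>, one sees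
  that \<open>g\<close> has a nonzero fixed vector iff there is \<open>F\<close> with \<open>F (g Q) = sign g * F Q\<close> for which
  some such quadruple gives a nonzero value.

  For odd \<open>n\<close> no such \<open>F\<close> exists for \<open>g = (1 2)(3 \<dots> n)\<close>: a function with
  \<open>F (g Q) = - F Q\<close> is supported on the pairs \<open>{1, j}\<close> and \<open>{2, j}\<close> with \<open>j \<ge> 3\<close>, takes opposite
  constant values on the two kinds, and hence has the form \<open>F {x, y} = u x + u y\<close>. For even \<open>n\<close> a
  suitable \<open>F\<close> is built from the cycles of \<open>g\<close>.
\<close>

section \<open>Semi-invariant functions on pairs\<close>

lemma sign_funpow:
  assumes "permutation p"
  shows "sign (p ^^ k) = sign p ^ k"
proof (induction k)
  case (Suc k)
  thus ?case using sign_compose[OF assms permutation_funpow[OF assms, of k]]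
    by (simp only: funpow.simps power_Suc)
qed simp

lemma funpow_image:
  fixes g :: "'a \<Rightarrow> 'a"
  shows "((`) g ^^ k) Q = (g ^^ k) ` Q"
  by (induction k) (auto simp: image_comp)

text \<open>The orbit size is the first return time of \<open>x\<close>, since the iterates before
  that time are distinct and exhaust the orbit. Iterates can therefore be compared through their
  exponents modulo this size.\<close>

lemma funpow_eq_iff_mod_card_orbit:
  assumes "x \<in> orbit g x"
  shows "(g ^^ i) x = (g ^^ j) x \<longleftrightarrow> i mod card (orbit g x) = j mod card (orbit g x)"
proof -
  define m where "m = funpow_dist1 g x x"
  have m: "(g ^^ m) x = x" "0 < m"
    unfolding m_def using funpow_dist1_prop[OF assms] by auto
  have inj: "inj_on (\<lambda>k. (g ^^ k) x) {0..<m}"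
    unfolding m_def using inj_on_funpow_dist1[OF assms] .
  have "orbit g x = (\<lambda>k. (g ^^ k) x) ` {0..<m}"
    unfolding m_def using orbit_conv_funpow_dist1[OF assms] .
  hence card: "card (orbit g x) = m" using card_image[OF inj] by simp
  have "(g ^^ i) x = (g ^^ j) x \<longleftrightarrow> (g ^^ (i mod m)) x = (g ^^ (j mod m)) x"
    using funpow_mod_eq[OF m(1)] by simp
  also have "\<dots> \<longleftrightarrow> i mod m = j mod m"
    using inj m(2) by (auto dest: inj_onD)
  finally show ?thesis unfolding card .
qed

text \<open>The value at \<open>(h ^^ k) x\<close> has to be \<open>s ^ k\<close>, extended by 0 off
  the orbit. This is well defined because every return time \<open>k\<close> satisfies
  \<open>s ^ k = 1\<close>; for \<open>s = -1\<close> that is the requirement that odd powers move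
  \<open>x\<close>. It serves both for \<open>g\<close> on points and for the image map of
  \<open>g\<close> on pairs.\<close>

lemma exists_semi_invariant_on_orbit:
  fixes s :: complex
  assumes h: "inj h" and x: "x \<in> orbit h x"
    and s: "s = 1 \<or> s = -1 \<and> (\<forall>k. odd k \<longrightarrow> (h ^^ k) x \<noteq> x)"
  obtains e where "e x = 1" "\<And>y. e (h y) = s * e y" "\<And>y. y \<notin> orbit h x \<Longrightarrow> e y = 0"
proof -
  \<comment> \<open>\<open>funpow_dist\<close> selects one exponent for each orbit point;
    \<open>pow\<close> below shows that the selection is immaterial.\<close>
  define e where "e = (\<lambda>y. if y \<in> orbit h x then s ^ funpow_dist h x y else 0)"
  have orb: "orbit h x = {(h ^^ k) x | k. True}" by (rule orbit_altdef_self_in[OF x])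
  have pow_le: "s ^ i = s ^ j" if "(h ^^ i) x = (h ^^ j) x" "i \<le> j" for i j
  proof -
    have "(h ^^ i) ((h ^^ (j - i)) x) = (h ^^ i) x"
      using that by (metis comp_apply funpow_add le_add_diff_inverse)
    hence "(h ^^ (j - i)) x = x" using inj_fn[OF h] by (simp add: inj_eq)
    hence "s ^ (j - i) = 1" using s by (cases "odd (j - i)") auto
    thus ?thesis using that(2) by (metis le_add_diff_inverse mult_1_right power_add)
  qed
  have pow: "s ^ i = s ^ j" if "(h ^^ i) x = (h ^^ j) x" for i j
    using pow_le[of i j] pow_le[of j i] that by (metis nat_le_linear)
  have e: "e ((h ^^ k) x) = s ^ k" for k
  proof -
    have "(h ^^ k) x \<in> orbit h x" unfolding orb by blast
    thus ?thesis unfolding e_def using pow[OF funpow_dist_prop] by simp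
  qed
  have "e x = 1" using e[of 0] by simp
  moreover have "e y = 0" if "y \<notin> orbit h x" for y using that unfolding e_def by simp
  moreover have "e (h y) = s * e y" for y
  proof (cases "y \<in> orbit h x")
    case True
    then obtain k where "y = (h ^^ k) x" unfolding orb by blast
    thus ?thesis using e[of k] e[of "Suc k"] by simp
  next
    case False
    \<comment> \<open>The complement of the orbit is also mapped into itself: cancelling
      \<open>h\<close> by injectivity would bring \<open>y\<close> back into the orbit.\<close>
    have "h y \<notin> orbit h x"
    proof
      assume "h y \<in> orbit h x"
      then obtain k where "h y = (h ^^ Suc k) x"
        unfolding orbit_altdef by (auto dest: gr0_implies_Suc)
      hence "y = (h ^^ k) x" using h by (simp add: inj_eq)
      thus False using False unfolding orb by blast
    qed
    thus ?thesis using False unfolding e_def by simp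
  qed
  ultimately show ?thesis using that by blast
qed

text \<open>If every point had an odd return time, the product \<open>M\<close> of these times would
  be odd with \<open>g ^^ M = id\<close>, so that \<open>sign g = sign g ^ M = 1\<close>.\<close>

lemma exists_even_cycle_if_sign_neg:
  assumes g: "g permutes X" and X: "finite X" and s: "sign g = -1"
  obtains x where "x \<in> X" "\<And>k. odd k \<Longrightarrow> (g ^^ k) x \<noteq> x"
proof -
  have "\<exists>x\<in>X. \<forall>k. odd k \<longrightarrow> (g ^^ k) x \<noteq> x"
  proof (rule ccontr)
    assume "\<not> ?thesis"
    then obtain k where k: "\<And>x. x \<in> X \<Longrightarrow> odd (k x) \<and> (g ^^ k x) x = x" by metis
    define M where "M = (\<Prod>x\<in>X. k x)"
    have "odd M" unfolding M_def using k X by (simp add: even_prod_iff)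
    have fixpt: "(g ^^ (c * a)) x = x" if "(g ^^ a) x = x" for a c x
      using that by (induction c) (simp_all add: funpow_add)
    have "(g ^^ M) x = x" for x
    proof (cases "x \<in> X")
      case True
      hence "k x dvd M" unfolding M_def using X by (intro dvd_prodI) auto
      then obtain c where "M = c * k x" by (metis dvdE mult.commute)
      thus ?thesis using fixpt k[OF True] by simp
    next
      case False
      hence "(g ^^ 1) x = x" using permutes_not_in[OF g] by simp
      from fixpt[OF this, of M] show ?thesis by simp
    qed
    hence "g ^^ M = id" by auto
    moreover have "permutation g" using g X permutation_permutes by blast
    ultimately have "sign g ^ M = 1" using sign_funpow[of g M] by simp
    thus False using s \<open>odd M\<close> by simp
  qed
  thus ?thesis using that by blast
qed

text \<open>
  A function on pairs has all these alternating sums equal to \<open>0\<close> if it is of the form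
  \<open>F {x, y} = u x + u y\<close>.
\<close>
definition quad_defect :: "('a set \<Rightarrow> complex) \<Rightarrow> 'a \<Rightarrow> 'a \<Rightarrow> 'a \<Rightarrow> 'a \<Rightarrow> complex" where
  "quad_defect F p q r s = F {p, r} - F {p, s} - F {q, r} + F {q, s}"

definition has_quad_defect :: "'a set \<Rightarrow> ('a set \<Rightarrow> complex) \<Rightarrow> bool" where
  "has_quad_defect X F \<longleftrightarrow>
     (\<exists>p q r s. distinct [p, q, r, s] \<and> {p, q, r, s} \<subseteq> X \<and> quad_defect F p q r s \<noteq> 0)"

section \<open>Constructions of semi-invariant functions with nonzero defect\<close>

text \<open>The indicator of the pairs contained in \<open>A\<close> is invariant, and among the
  four pairs entering the defect at \<open>p, q, r, s\<close> only \<open>{p, r}\<close> lies inside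
  \<open>A\<close>.\<close>

lemma invariant_subset_quad_defect:
  assumes g: "g permutes X" and A: "A \<subseteq> X" "g ` A = A"
    and p: "p \<in> A" "r \<in> A" "p \<noteq> r" and q: "q \<in> X - A" "s \<in> X - A" "q \<noteq> s"
  obtains F where "\<And>Q. F (g ` Q) = F Q" "has_quad_defect X F"
proof
  define F where "F = (\<lambda>Q. of_bool (Q \<subseteq> A) :: complex)"
  have "g ` Q \<subseteq> A \<longleftrightarrow> Q \<subseteq> A" for Q
    using inj_image_subset_iff[OF permutes_inj[OF g], of Q A] A(2) by simp
  thus "F (g ` Q) = F Q" for Q unfolding F_def by simp
  have "quad_defect F p q r s = 1" using p q unfolding quad_defect_def F_def by auto
  thus "has_quad_defect X F" unfolding has_quad_defect_def using p q A
    by (intro exI[of _ p] exI[of _ q] exI[of _ r] exI[of _ s]) auto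
qed

text \<open>Viewing the cycle of \<open>x\<close> as a polygon, \<open>F\<close> lives on its edges,
  which form the orbit of \<open>{x, g x}\<close>. At \<open>x, q, g x, (g ^^ 2) x\<close> the only
  edge that counts is \<open>{x, g x}\<close>, provided that \<open>q\<close> is adjacent to neither
  \<open>g x\<close> nor \<open>(g ^^ 2) x\<close>.\<close>

lemma cycle_quad_defect:
  fixes s :: complex
  assumes g: "g permutes X" "finite X" and x: "x \<in> X" and m: "m = card (orbit g x)" "m \<ge> 5"
    and s: "s = 1 \<or> s = -1 \<and> even m"
    and z: "m \<ge> 6 \<or> (\<exists>z\<in>X. z \<notin> orbit g x)"
  obtains F where "\<And>Q. F (g ` Q) = s * F Q" "has_quad_defect X F"
proof -
  have pg: "permutation g" using g permutation_permutes by blast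
  have xo: "x \<in> orbit g x" by (rule permutation_self_in_orbit[OF pg])
  have orb: "orbit g x = {(g ^^ k) x | k. True}" by (rule orbit_altdef_self_in[OF xo])
  note eq = funpow_eq_iff_mod_card_orbit[OF xo, folded m(1)]
  define P where "P = {x, g x}"
  have pow: "(g ^^ k) ` P = {(g ^^ k) x, (g ^^ Suc k) x}" for k
    unfolding P_def by (simp add: funpow_swap1)
  have adj: "(j mod m = Suc i mod m) \<or> (i mod m = Suc j mod m)"
    if "{(g ^^ i) x, (g ^^ j) x} = (g ^^ k) ` P" for i j k
    using that unfolding pow doubleton_eq_iff eq by (metis mod_Suc_eq)
  have inj: "inj ((`) g)" using permutes_inj[OF g(1)] by (simp add: inj_image_eq_iff inj_def)
  obtain N where N: "g ^^ N = id" "N > 0"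
    using permutation_is_nilpotent[OF pg] by blast
  \<comment> \<open>\<open>orbit\<close> uses positive exponents only, so membership of
    \<open>P\<close> needs a positive power of \<open>g\<close> that fixes it.\<close>
  have Po: "P \<in> orbit ((`) g) P"
    unfolding orbit_altdef funpow_image using N by (auto intro!: exI[of _ N])
  have sk: "s = 1 \<or> s = -1 \<and> (\<forall>k. odd k \<longrightarrow> ((`) g ^^ k) P \<noteq> P)"
  proof -
    have "even k" if "even m" "(g ^^ k) ` P = P" for k
    proof -
      have "{(g ^^ k) x, (g ^^ Suc k) x} = {(g ^^ 0) x, (g ^^ 1) x}"
        using that(2) unfolding pow by (simp add: P_def)
      \<comment> \<open>The second alternative would turn the edge \<open>P\<close> around, which
        forces \<open>m\<close> to divide 2. Hence the return times of \<open>P\<close> are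
        multiples of \<open>m\<close>, and even if \<open>m\<close> is.\<close>
      hence "k mod m = 0 mod m \<or> k mod m = 1 mod m \<and> Suc k mod m = 0 mod m"
        unfolding doubleton_eq_iff eq by blast
      moreover have "k mod m \<noteq> 1 mod m \<or> Suc k mod m \<noteq> 0 mod m"
        using mod_Suc_eq[of k m] m(2) by auto
      ultimately have "m dvd k" by auto
      thus ?thesis using that(1) by (rule dvd_trans[rotated])
    qed
    thus ?thesis using s unfolding funpow_image by blast
  qed
  obtain F where F: "F P = 1" "\<And>Q. F (g ` Q) = s * F Q"
    "\<And>Q. Q \<notin> orbit ((`) g) P \<Longrightarrow> F Q = 0"
    by (rule exists_semi_invariant_on_orbit[OF inj Po sk]) blast
  have F0: "F Q = 0" if "\<And>k. Q \<noteq> (g ^^ k) ` P" for Q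
    using that F(3) unfolding orbit_altdef funpow_image by blast
  have P1: "F {x, g x} = 1" using F(1) unfolding P_def .
  have P2: "F {x, (g ^^ 2) x} = 0"
    by (rule F0) (use adj[of 0 2] m(2) in auto)
  have inX: "(g ^^ k) x \<in> X" for k
    using permutes_orbit_subset[OF g(1) x] orb by blast
  have ne: "x \<noteq> g x" "x \<noteq> (g ^^ 2) x" "g x \<noteq> (g ^^ 2) x"
    using eq[of 0 1] eq[of 0 2] eq[of 1 2] m(2) by auto
  \<comment> \<open>For \<open>m >= 6\<close> the vertex \<open>(g ^^ 4) x\<close> is at distance at
    least 2 from \<open>g x\<close> and \<open>(g ^^ 2) x\<close>; otherwise a point off the cycle,
    which lies on no edge, is taken.\<close>
  have "\<exists>q\<in>X. q \<noteq> x \<and> q \<noteq> g x \<and> q \<noteq> (g ^^ 2) x \<and> F {q, g x} = 0 \<and> F {q, (g ^^ 2) x} = 0"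
  proof (cases "m \<ge> 6")
    case True
    have "F {(g ^^ 4) x, (g ^^ 1) x} = 0" "F {(g ^^ 4) x, (g ^^ 2) x} = 0"
      by (rule F0, use adj[of 4 1] adj[of 4 2] True in auto)+
    moreover have "(g ^^ 4) x \<noteq> x" "(g ^^ 4) x \<noteq> g x" "(g ^^ 4) x \<noteq> (g ^^ 2) x"
      using eq[of 4 0] eq[of 4 1] eq[of 4 2] True by auto
    ultimately show ?thesis using inX[of 4] by (intro bexI[of _ "(g ^^ 4) x"]) auto
  next
    case False
    then obtain z where z: "z \<in> X" "z \<notin> orbit g x" using assms(7) by blast
    hence nz: "z \<noteq> (g ^^ k) x" for k using orb by blast
    have "F {z, y} = 0" for y by (rule F0) (use nz in \<open>metis insertCI insertE empty_iff pow\<close>)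
    thus ?thesis using z(1) nz[of 0] nz[of 1] nz[of 2] by (intro bexI[of _ z]) auto
  qed
  then obtain q where q: "q \<in> X" "q \<noteq> x" "q \<noteq> g x" "q \<noteq> (g ^^ 2) x"
    "F {q, g x} = 0" "F {q, (g ^^ 2) x} = 0" by blast
  have "quad_defect F x q (g x) ((g ^^ 2) x) = 1"
    unfolding quad_defect_def P1 P2 q by simp
  moreover have "{x, q, g x, (g ^^ 2) x} \<subseteq> X" using q inX[of 0] inX[of 1] inX[of 2] by simp
  moreover have "distinct [x, q, g x, (g ^^ 2) x]" using q(2-4) ne by auto
  ultimately have "has_quad_defect X F"
    unfolding has_quad_defect_def by (intro exI conjI) auto
  thus ?thesis using that F(2) by blast
qed

text \<open>On an even cycle there is a function \<open>e\<close> alternating between 1 and -1.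
  Restricting the sum of \<open>e\<close> over \<open>Q\<close> to the sets \<open>Q\<close> that
  meet the invariant set \<open>B\<close> keeps \<open>F\<close> anti-invariant. On two-element sets
  \<open>F\<close> is then nonzero only for pairs joining the cycle to \<open>B\<close>, with the
  value of \<open>e\<close> at the cycle point.\<close>

lemma even_cycle_quad_defect:
  assumes g: "g permutes X" "finite X" and x: "x \<in> X" "\<And>k. odd k \<Longrightarrow> (g ^^ k) x \<noteq> x"
    and B: "B \<subseteq> X - orbit g x" "g ` B = B" "b \<in> B"
    and alt: "(\<exists>z\<in>X. z \<notin> orbit g x \<and> z \<notin> B) \<or> (\<exists>b'\<in>B. b' \<noteq> b) \<and> (g ^^ 2) x \<noteq> x"
  obtains F where "\<And>Q. F (g ` Q) = - F Q" "has_quad_defect X F"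
proof -
  have pg: "permutation g" using g permutation_permutes by blast
  have xo: "x \<in> orbit g x" by (rule permutation_self_in_orbit[OF pg])
  have inj: "inj g" using permutes_inj[OF g(1)] .
  obtain e :: "'a \<Rightarrow> complex" where e: "e x = 1" "\<And>y. e (g y) = - 1 * e y"
    "\<And>y. y \<notin> orbit g x \<Longrightarrow> e y = 0"
    by (rule exists_semi_invariant_on_orbit[OF inj xo, of "-1"]) (use x(2) in auto)
  have sub: "orbit g x \<subseteq> X" by (rule permutes_orbit_subset[OF g(1) x(1)])
  have gx: "g x \<in> orbit g x" "(g ^^ 2) x \<in> orbit g x"
    by (auto simp: numeral_2_eq_2 intro: orbit.intros)
  have e0: "e y = 0" if "y \<in> B" for y using e(3) that B(1) by blast
  define F where "F = (\<lambda>Q. sum e Q * of_bool (Q \<inter> B \<noteq> {}))"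
  have F2: "F {u, v} = (e u + e v) * of_bool (u \<in> B \<or> v \<in> B)" if "u \<noteq> v" for u v
    using that unfolding F_def by auto
  have "F (g ` Q) = - F Q" for Q
  proof -
    have "g ` Q \<inter> B \<noteq> {} \<longleftrightarrow> Q \<inter> B \<noteq> {}"
      using B(2) inj by (metis image_Int image_is_empty)
    moreover have "sum e (g ` Q) = - sum e Q"
      using inj by (subst sum.reindex) (auto simp: e(2) sum_negf inj_on_def dest: injD)
    ultimately show ?thesis unfolding F_def by simp
  qed
  moreover have "has_quad_defect X F"
    using alt
  proof
    assume "\<exists>z\<in>X. z \<notin> orbit g x \<and> z \<notin> B"
    then obtain z where z: "z \<in> X" "z \<notin> orbit g x" "z \<notin> B" by blast
    have ne: "x \<noteq> g x" "b \<noteq> x" "b \<noteq> g x" "z \<noteq> x" "z \<noteq> g x" "b \<noteq> z" "x \<notin> B" "g x \<notin> B"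
      using x(2)[of 1] B gx xo z by auto
    \<comment> \<open>The pairs containing \<open>z\<close> give 0, while \<open>{x, b}\<close> and
      \<open>{g x, b}\<close> give 1 and -1, the latter with a minus sign in the defect.\<close>
    have "quad_defect F x (g x) b z = 2"
      unfolding quad_defect_def using ne e e0 B(3) z by (simp add: F2)
    thus ?thesis unfolding has_quad_defect_def using ne z B sub gx x(1)
      by (intro exI[of _ x] exI[of _ "g x"] exI[of _ b] exI[of _ z]) auto
  next
    assume "(\<exists>b'\<in>B. b' \<noteq> b) \<and> (g ^^ 2) x \<noteq> x"
    then obtain b' where b: "b' \<in> B" "b' \<noteq> b" and x2: "(g ^^ 2) x \<noteq> x" by blast
    have ne: "b \<noteq> x" "b \<noteq> (g ^^ 2) x" "b' \<noteq> x" "b' \<noteq> (g ^^ 2) x" "x \<notin> B" "(g ^^ 2) x \<notin> B"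
      using B gx xo b by auto
    have "e ((g ^^ 2) x) = 1" using e by (simp add: numeral_2_eq_2)
    \<comment> \<open>The pairs \<open>{x, b}\<close> and \<open>{b', (g ^^ 2) x}\<close> give 1
      each; the pair inside the cycle and the pair inside \<open>B\<close> give 0.\<close>
    hence "quad_defect F x b' b ((g ^^ 2) x) = 2"
      unfolding quad_defect_def using ne e e0 B(3) b x2 by (simp add: F2 x2[symmetric])
    thus ?thesis unfolding has_quad_defect_def using ne b x2 B sub gx x(1)
      by (intro exI[of _ x] exI[of _ b'] exI[of _ b] exI[of _ "(g ^^ 2) x"]) auto
  qed
  ultimately show ?thesis using that by blast
qed

section \<open>Even degree: a suitable function for every permutation\<close>

text \<open>The constructions cover all cycle types. For sign 1, an orbit with at least two points
  inside and outside is an invariant set to use; otherwise there is a cycle on all or all but one of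
  the points, or \<open>g\<close> fixes \<open>X\<close> pointwise. For sign -1, an even cycle
  exists and is combined with a second orbit, unless it fills \<open>X\<close>.\<close>

lemma exists_semi_invariant_quad_defect:
  assumes g: "g permutes X" and X: "finite X" "even (card X)" "card X \<ge> 6"
  obtains F where "\<And>Q. F (g ` Q) = of_int (sign g) * F Q" "has_quad_defect X F"
proof -
  have pg: "permutation g" using g X permutation_permutes by blast
  have self: "x \<in> orbit g x" for x by (rule permutation_self_in_orbit[OF pg])
  have sub: "orbit g x \<subseteq> X" if "x \<in> X" for x by (rule permutes_orbit_subset[OF g that])
  have fin: "finite (orbit g x)" for x by (rule finite_orbit[OF self])
  have img: "g ` orbit g x = orbit g x" for x
  proof (rule endo_inj_surj[OF fin])
    show "g ` orbit g x \<subseteq> orbit g x" by (auto intro: orbit.step)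
    show "inj_on g (orbit g x)" using permutes_inj[OF g] by (rule inj_on_subset) simp
  qed
  have two: "\<exists>p\<in>A. \<exists>q\<in>A. p \<noteq> q" if "card A \<ge> 2" for A :: "'a set"
  proof -
    have "finite A" using that card.infinite[of A] by fastforce
    hence "\<not> (\<forall>a1\<in>A. \<forall>a2\<in>A. a1 = a2)" using that card_le_Suc0_iff_eq[of A] by simp
    thus ?thesis by blast
  qed
  have card1: "card (orbit g x) \<ge> 1" for x
    using fin self by (metis One_nat_def Suc_leI card_gt_0_iff empty_iff)
  note eq = funpow_eq_iff_mod_card_orbit[OF self]
  consider "sign g = 1" | "sign g = -1" by (cases g rule: sign_cases) auto
  thus ?thesis
  proof cases
    case 1
    have "\<exists>F. (\<forall>Q. F (g ` Q) = F Q) \<and> has_quad_defect X F"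
    proof -
      consider (mid) x where "x \<in> X" "card (orbit g x) \<ge> 2" "card (orbit g x) + 2 \<le> card X"
        | (large) x where "x \<in> X" "card (orbit g x) \<ge> card X - 1"
        | (small) "\<forall>x\<in>X. card (orbit g x) = 1"
      proof -
        have "card (orbit g x) = 1"
          if "\<not> (card (orbit g x) \<ge> 2 \<and> card (orbit g x) + 2 \<le> card X)"
            "\<not> card (orbit g x) \<ge> card X - 1" for x
          using that card1[of x] by linarith
        thus ?thesis using mid large small by blast
      qed
      thus ?thesis
      proof cases
        case mid
        obtain p r where "p \<in> orbit g x" "r \<in> orbit g x" "p \<noteq> r" using two[OF mid(2)] by blast
        moreover have "card (X - orbit g x) \<ge> 2"
          using card_Diff_subset[OF fin sub[OF mid(1)]] mid(3) by simp
        then obtain q s where "q \<in> X - orbit g x" "s \<in> X - orbit g x" "q \<noteq> s"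
          using two by blast
        ultimately show ?thesis
          using invariant_subset_quad_defect[OF g sub[OF mid(1)] img] by metis
      next
        case large
        have "card (orbit g x) \<ge> 6 \<or> (\<exists>z\<in>X. z \<notin> orbit g x)"
          using X(3) sub[OF large(1)] by (metis subsetI subset_antisym)
        moreover have "5 \<le> card (orbit g x)" using large(2) X(3) by simp
        ultimately show ?thesis
          using cycle_quad_defect[OF g X(1) large(1) refl, of 1] by (metis mult_1)
      next
        case small
        have fixed: "g x = x" if "x \<in> X" for x
          using small that eq[of 1 x 0] by simp
        obtain A where A: "A \<subseteq> X" "card A = 2"
          using X(3) by (meson obtain_subset_with_card_n le_trans numeral_le_iff semiring_norm(68,69,71))
        have "card (X - A) \<ge> 2"
          using card_Diff_subset[OF finite_subset[OF A(1) X(1)] A(1)] A(2) X(3) by simp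
        then obtain q s where qs: "q \<in> X - A" "s \<in> X - A" "q \<noteq> s" using two by blast
        obtain p r where pr: "p \<in> A" "r \<in> A" "p \<noteq> r" using two[of A] A(2) by auto
        have "g ` A = A" using fixed A(1) by force
        thus ?thesis using invariant_subset_quad_defect[OF g A(1) _ pr qs] by metis
      qed
    qed
    thus ?thesis using that 1 by auto
  next
    case 2
    obtain x where x: "x \<in> X" "\<And>k. odd k \<Longrightarrow> (g ^^ k) x \<noteq> x"
      using exists_even_cycle_if_sign_neg[OF g X(1) 2] by blast
    let ?A = "orbit g x"
    \<comment> \<open>The size of the orbit is itself a return time of \<open>x\<close>, and these
      are even.\<close>
    have evA: "even (card ?A)" using x(2) eq[of "card ?A" x 0] by auto
    have "\<exists>F. (\<forall>Q. F (g ` Q) = - F Q) \<and> has_quad_defect X F"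
    proof (cases "?A = X")
      case True
      obtain F where "\<And>Q. F (g ` Q) = - 1 * F Q" "has_quad_defect X F"
        by (rule cycle_quad_defect[OF g X(1) x(1) refl, of "- 1"]) (use True X evA in auto)
      thus ?thesis by auto
    next
      case False
      then obtain b where b: "b \<in> X" "b \<notin> ?A" using sub[OF x(1)] by blast
      let ?B = "orbit g b"
      have disj: "?A \<inter> ?B = {}"
        using b(2) by (metis disjoint_iff orbit_swap orbit_trans self)
      have B: "?B \<subseteq> X - ?A" and A: "?A \<subseteq> X - ?B"
        using sub[OF b(1)] sub[OF x(1)] disj by auto
      show ?thesis
      proof (cases "\<exists>z\<in>X. z \<notin> ?A \<and> z \<notin> ?B")
        case True
        show ?thesis
          using even_cycle_quad_defect[OF g X(1) x B img self disjI1[OF True]] by metis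
      next
        case False
        hence "X = ?A \<union> ?B" using A B by blast
        hence card: "card X = card ?A + card ?B" using card_Un_disjoint[OF fin fin disj] by simp
        \<comment> \<open>Here the parity of \<open>card X\<close> enters: if two cycles fill
          \<open>X\<close>, both are even and either one can carry the alternating function.\<close>
        hence evB: "even (card ?B)" using X(2) evA by simp
        have ge2: "card ?A \<ge> 2" "card ?B \<ge> 2" using evA evB card1[of x] card1[of b]
          by (metis One_nat_def Suc_1 even_Suc le_antisym not_less_eq_eq odd_one)+
        have other: "\<exists>c'\<in>C. c' \<noteq> c" if "card C \<ge> 2" for C and c :: 'a using two[OF that] by metis
        show ?thesis
        proof (cases "card ?A = 2")
          case False
          hence "(g ^^ 2) x \<noteq> x" using ge2 eq[of 2 x 0] by auto
          hence alt: "(\<exists>b'\<in>?B. b' \<noteq> b) \<and> (g ^^ 2) x \<noteq> x" using other[OF ge2(2)] by blast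
          show ?thesis
            using even_cycle_quad_defect[OF g X(1) x B img self disjI2[OF alt]] by metis
        next
          case True
          have odd: "(g ^^ k) b \<noteq> b" if "odd k" for k
          proof
            assume "(g ^^ k) b = b"
            hence "card ?B dvd k" using eq[of k b 0] by auto
            thus False using evB that by (metis dvd_trans)
          qed
          \<comment> \<open>As \<open>card X >= 6\<close> and the first cycle has length 2, the
            second is longer than 2; the two cycles exchange their roles.\<close>
          have "(g ^^ 2) b \<noteq> b" using True card X(3) eq[of 2 b 0] by auto
          hence alt: "(\<exists>b'\<in>?A. b' \<noteq> x) \<and> (g ^^ 2) b \<noteq> b" using other[OF ge2(1)] by blast
          show ?thesis
            using even_cycle_quad_defect[OF g X(1) b(1) odd A img self disjI2[OF alt]] by metis
        qed
      qed
    qed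
    thus ?thesis using that 2 by auto
  qed
qed

section \<open>Odd degree: a permutation for which every defect vanishes\<close>

text \<open>Since \<open>n - 2\<close> is odd, the power \<open>g ^^ (n - 2)\<close> is the
  transposition of 1 and 2. So a function with the sign of \<open>g\<close> changes sign under the
  transposition and is invariant under the long cycle \<open>c\<close>, which determines it up to a
  scalar on pairs.\<close>

lemma exists_permutation_without_quad_defect:
  fixes n :: nat
  assumes n: "odd n" "n \<ge> 5"
  obtains g where "g permutes {1..n}"
    "\<And>F. (\<And>Q. F (g ` Q) = of_int (sign g) * F Q) \<Longrightarrow> \<not> has_quad_defect {1..n} F"
proof -
  let ?X = "{1..n}" and ?\<tau> = "transpose (1::nat) 2"
  \<comment> \<open>The cycle \<open>(3 ... n)\<close>, as addition of 1 modulo \<open>n - 2\<close>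
    after shifting by 3.\<close>
  define c where "c = (\<lambda>x. if x \<in> {3..n} then 3 + (x - 3 + 1) mod (n - 2) else x)"
  define g where "g = ?\<tau> \<circ> c"
  have c_pow: "(c ^^ k) x = (if x \<in> {3..n} then 3 + (x - 3 + k) mod (n - 2) else x)" for k x
  proof (induction k)
    case 0
    have "x - 3 < n - 2" if "x \<in> {3..n}" using that by auto
    thus ?case by auto
  next
    case (Suc k)
    have "3 + (x - 3 + k) mod (n - 2) \<le> n"
      using n(2) mod_less_divisor[of "n - 2" "x - 3 + k"] by linarith
    thus ?case using Suc by (auto simp: c_def mod_Suc_eq)
  qed
  have cycle: "3 + (x - 3 + (n - 2)) mod (n - 2) = x" if "x \<in> {3..n}" for x
    using that by (subst mod_add_self2) auto
  have c_id: "c ^^ (n - 2) = id" unfolding fun_eq_iff c_pow using cycle by simp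
  have bij_c: "bij c"
  proof (rule o_bij)
    have "n - 2 = Suc (n - 3)" using n(2) by simp
    thus "c \<circ> c ^^ (n - 3) = id" "c ^^ (n - 3) \<circ> c = id"
      using c_id by (metis funpow.simps(2), metis funpow_Suc_right)
  qed
  have c_perm: "c permutes ?X"
    unfolding permutes_def bij_iff[symmetric] using bij_c by (auto simp: c_def)
  have \<tau>_perm: "?\<tau> permutes ?X" using n(2) by (intro permutes_swap_id) auto
  have g_perm: "g permutes ?X" unfolding g_def by (rule permutes_compose[OF c_perm \<tau>_perm])
  have pc: "permutation c" "permutation ?\<tau>"
    using c_perm \<tau>_perm permutation_permutes by blast+
  have "sign c ^ (n - 2) = 1" using sign_funpow[OF pc(1), of "n - 2"] c_id by simp
  \<comment> \<open>The exponent \<open>n - 2\<close> is odd, which excludes the sign -1.\<close>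
  hence "sign c = 1" using n by (cases c rule: sign_cases) auto
  hence sg: "sign g = -1" unfolding g_def using pc by (simp add: sign_compose sign_swap_id)
  have g_pow: "(g ^^ k) x = (if x \<in> {3..n} then 3 + (x - 3 + k) mod (n - 2) else (?\<tau> ^^ k) x)"
    for k x
  proof (induction k)
    case 0
    have "x - 3 < n - 2" if "x \<in> {3..n}" using that by auto
    thus ?case by auto
  next
    case (Suc k)
    define y where "y = 3 + (x - 3 + k) mod (n - 2)"
    have "(x - 3 + k) mod (n - 2) < n - 2" using n(2) by (intro mod_less_divisor) simp
    hence y: "y \<in> {3..n}" unfolding y_def by simp
    have cy: "c y = 3 + (x - 3 + Suc k) mod (n - 2)"
      using y unfolding c_def by (simp add: y_def mod_Suc_eq)
    have "?\<tau> (3 + z) = 3 + z" for z by (simp add: transpose_def)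
    hence gy: "g y = 3 + (x - 3 + Suc k) mod (n - 2)" unfolding g_def comp_apply cy .
    have "(?\<tau> ^^ k) x \<notin> {3..n}" if "x \<notin> {3..n}"
      using that by (induction k) (auto simp: transpose_def)
    moreover have "c z = z" if "z \<notin> {3..n}" for z using that by (auto simp: c_def)
    ultimately have "g ((?\<tau> ^^ k) x) = ?\<tau> ((?\<tau> ^^ k) x)" if "x \<notin> {3..n}"
      using that unfolding g_def comp_apply by metis
    thus ?case using Suc gy unfolding y_def
      by (cases "x \<in> {3..n}") (simp_all only: funpow.simps comp_apply if_True if_False simp_thms)
  qed
  have \<tau>_pow: "?\<tau> ^^ k = (if even k then id else ?\<tau>)" for k
    by (induction k) auto
  have g_odd: "g ^^ (n - 2) = ?\<tau>"
  proof
    fix x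
    show "(g ^^ (n - 2)) x = ?\<tau> x"
      unfolding g_pow \<tau>_pow using n cycle[of x] by (simp add: transpose_def)
  qed
  have "\<not> has_quad_defect ?X F" if F: "\<And>Q. F (g ` Q) = of_int (sign g) * F Q" for F
  proof -
    have F': "F ((g ^^ k) ` Q) = (-1) ^ k * F Q" for k Q
    proof (induction k)
      case (Suc k)
      have "(g ^^ Suc k) ` Q = g ` (g ^^ k) ` Q" by auto
      thus ?case using F[of "(g ^^ k) ` Q"] Suc sg by simp
    qed simp
    have F\<tau>: "F (?\<tau> ` Q) = - F Q" for Q using F'[of "n - 2" Q] g_odd n by simp
    have Fc: "F (c ` Q) = F Q" for Q
    proof -
      have "F (g ` Q) = F (?\<tau> ` c ` Q)" unfolding g_def by (simp add: image_comp)
      thus ?thesis using F\<tau>[of "c ` Q"] F[of Q] sg by simp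
    qed
    \<comment> \<open>This applies to \<open>{1, 2}\<close> and to every pair inside
      \<open>{3..n}\<close>.\<close>
    have F0: "F Q = 0" if "?\<tau> ` Q = Q" for Q using F\<tau>[of Q] that by simp
    have F1: "F {1, j} = F {1, 3}" if "3 \<le> j" "j \<le> n" for j
      using that
    proof (induction j rule: dec_induct)
      case (step j)
      have "c ` {1, j} = {1, Suc j}" using step by (auto simp: c_def)
      thus ?case using Fc[of "{1, j}"] step by simp
    qed simp
    have F2: "F {2, j} = - F {1, 3}" if "3 \<le> j" "j \<le> n" for j
    proof -
      have "?\<tau> ` {1, j} = {2, j}" using that by (auto simp: transpose_def)
      thus ?thesis using F\<tau>[of "{1, j}"] F1[OF that] by simp
    qed
    \<comment> \<open>The potential of \<open>F\<close>: with \<open>F {x, y} = u x + u y\<close>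
      each \<open>u\<close> value occurs in a defect once with either sign.\<close>
    define u where "u = (\<lambda>x::nat. if x = 1 then F {1, 3} else if x = 2 then - F {1, 3} else 0)"
    have lt: "F {x, y} = u x + u y" if xy: "x < y" "x \<in> ?X" "y \<in> ?X" for x y
    proof -
      consider "x = 1" "y = 2" | "x = 1" "y \<ge> 3" | "x = 2" "y \<ge> 3" | "x \<ge> 3" "y \<ge> 3"
        using xy by fastforce
      thus ?thesis
      proof cases
        case 1
        have "F {1, 2} = 0" by (rule F0) auto
        thus ?thesis using 1 by (simp add: u_def)
      next
        case 2
        thus ?thesis using F1[of y] xy by (simp add: u_def)
      next
        case 3
        thus ?thesis using F2[of y] xy by (simp add: u_def)
      next
        case 4
        have "F {x, y} = 0" by (rule F0) (use 4 in \<open>auto simp: transpose_def\<close>)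
        thus ?thesis using 4 by (simp add: u_def)
      qed
    qed
    have "F {x, y} = u x + u y" if "x \<noteq> y" "x \<in> ?X" "y \<in> ?X" for x y
      using lt[of x y] lt[of y x] that by (cases "x < y") (auto simp: insert_commute)
    thus ?thesis unfolding has_quad_defect_def quad_defect_def by auto
  qed
  thus ?thesis using that g_perm by blast
qed

section \<open>The Specht module as a quotient of the functions on pairs\<close>

definition two_col :: "nat \<Rightarrow> nat list" where
  "two_col n = [2, 2] @ replicate (n - 4) 1"

lemma sum_list_two_col: "n \<ge> 4 \<Longrightarrow> sum_list (two_col n) = n"
  by (simp add: two_col_def sum_list_replicate)

lemma length_two_col: "n \<ge> 4 \<Longrightarrow> length (two_col n) = n - 2"
  by (simp add: two_col_def)

lemma young_diagram_two_col:
  assumes "n \<ge> 4"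
  shows "young_diagram (two_col n) = {..<n - 2} \<times> {0} \<union> {(0, 1), (1, 1)}"
proof -
  have nth: "two_col n ! i = (if i < 2 then 2 else 1)" if "i < n - 2" for i
    using that assms by (auto simp: two_col_def nth_append less_2_cases_iff nth_Cons
        split: nat.splits)
  have "(i, j) \<in> young_diagram (two_col n) \<longleftrightarrow>
      (i, j) \<in> {..<n - 2} \<times> {0} \<union> {(0, 1), (1, 1)}" for i j
    using nth[of i] assms by (auto simp: young_diagram_def length_two_col split: if_splits)
  thus ?thesis unfolding set_eq_iff split_paired_All by (intro allI)
qed

lemma tableau_column_two_col:
  assumes "n \<ge> 4"
  shows "tableau_column (two_col n) t j =
    (if j = 0 then t ` ({..<n - 2} \<times> {0}) else if j = 1 then {t (0, 1), t (1, 1)} else {})"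
  using assms unfolding tableau_column_def young_diagram_two_col[OF assms] by auto

lemma tableau_row_two_col:
  assumes "n \<ge> 4" "i < n - 2"
  shows "tableau_row (two_col n) t i = (if i < 2 then {t (i, 0), t (i, 1)} else {t (i, 0)})"
  using assms unfolding tableau_row_def young_diagram_two_col[OF assms(1)]
  by (auto simp: less_2_cases_iff)

text \<open>
  Choosing the second column determines the first one, so up to sign the polytabloids of this shape
  are indexed by pairs \<open>Q\<close>; \<open>signed_tabloid_sum n t f\<close> is the combination of these
  polytabloids with coefficients \<open>\<plusminus> f Q\<close>.
\<close>
definition signed_tabloid_sum ::
  "nat \<Rightarrow> (nat \<times> nat \<Rightarrow> nat) \<Rightarrow> (nat set \<Rightarrow> complex) \<Rightarrow> nat set list \<Rightarrow> complex" where
  "signed_tabloid_sum n t f = (\<lambda>T. \<Sum>p | p permutes {1..n}.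
     if tabloid (two_col n) (p \<circ> t) = T then of_int (sign p) * f (p ` {t (0, 1), t (1, 1)}) else 0)"

section \<open>Linearity and equivariance of signed tabloid sums\<close>

lemma signed_tabloid_sum_add:
  "signed_tabloid_sum n t (\<lambda>Q. f Q + f' Q) =
     signed_tabloid_sum n t f + signed_tabloid_sum n t f'"
  unfolding signed_tabloid_sum_def fun_eq_iff plus_fun_apply sum.distrib[symmetric]
  by (intro allI sum.cong refl) (simp add: distrib_left)

lemma signed_tabloid_sum_scale:
  "signed_tabloid_sum n t (\<lambda>Q. c * f Q) = (\<lambda>T. c * signed_tabloid_sum n t f T)"
  unfolding signed_tabloid_sum_def sum_distrib_left
  by (intro ext sum.cong refl) simp

lemma signed_tabloid_sum_0: "signed_tabloid_sum n t (\<lambda>Q. 0) = 0"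
  using signed_tabloid_sum_scale[of n t 0 "\<lambda>_. 0"] by (auto simp: fun_eq_iff)

lemma signed_tabloid_sum_sum:
  "finite A \<Longrightarrow> signed_tabloid_sum n t (\<lambda>Q. \<Sum>a\<in>A. f a Q) = (\<Sum>a\<in>A. signed_tabloid_sum n t (f a))"
proof (induction A rule: finite_induct)
  case empty
  show ?case using signed_tabloid_sum_0[of n t] by (simp only: sum.empty)
next
  case (insert a A)
  have e: "(\<lambda>Q. \<Sum>a\<in>insert a A. f a Q) = (\<lambda>Q. f a Q + (\<Sum>a\<in>A. f a Q))"
    using insert.hyps by (intro ext sum.insert)
  have "signed_tabloid_sum n t (\<lambda>Q. \<Sum>a\<in>insert a A. f a Q) =
      signed_tabloid_sum n t (f a) + signed_tabloid_sum n t (\<lambda>Q. \<Sum>a\<in>A. f a Q)"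
    unfolding e by (rule signed_tabloid_sum_add)
  also have "\<dots> = (\<Sum>a\<in>insert a A. signed_tabloid_sum n t (f a))"
    by (simp only: insert.IH sum.insert[OF insert.hyps])
  finally show ?case .
qed

lemma signed_tabloid_sum_cong:
  assumes "bij_betw t (young_diagram (two_col n)) {1..n}" "n \<ge> 4"
    and "\<And>Q. Q \<subseteq> {1..n} \<Longrightarrow> f Q = f' Q"
  shows "signed_tabloid_sum n t f = signed_tabloid_sum n t f'"
proof -
  have "{t (0, 1), t (1, 1)} \<subseteq> {1..n}"
    using bij_betw_apply[OF assms(1), of "(0, 1)"] bij_betw_apply[OF assms(1), of "(1, 1)"]
      young_diagram_two_col[OF assms(2)] by simp
  hence "p ` {t (0, 1), t (1, 1)} \<subseteq> {1..n}" if "p permutes {1..n}" for p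
    using permutes_image[OF that] by blast
  thus ?thesis unfolding signed_tabloid_sum_def using assms(3)
    by (intro ext sum.cong refl) (metis mem_Collect_eq)
qed

text \<open>Substituting \<open>g \<circ> p\<close> for \<open>p\<close> moves the action from
  tabloids to pairs and costs the factor \<open>sign g\<close>. This is the origin of the sign
  twist.\<close>

lemma tabloid_rep_signed_tabloid_sum:
  assumes g: "g permutes {1..n}"
  shows "tabloid_rep g (signed_tabloid_sum n t f) =
    signed_tabloid_sum n t (\<lambda>Q. of_int (sign g) * f (inv' g ` Q))"
proof
  fix T
  let ?h = "inv' g"
  note h = permutes_inv[OF g]
  have gh: "g \<circ> ?h = id" "?h \<circ> g = id" using permutes_inv_o[OF g] by auto
  have map_gh: "map ((`) g) (map ((`) ?h) U) = U" "map ((`) ?h) (map ((`) g) U) = U"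
    for U :: "nat set list"
    using gh by (simp_all add: image_comp map_idI)
  have perm: "permutation g" using g by (auto simp: permutation_permutes)
  show "tabloid_rep g (signed_tabloid_sum n t f) T =
    signed_tabloid_sum n t (\<lambda>Q. of_int (sign g) * f (?h ` Q)) T"
    unfolding tabloid_rep_def signed_tabloid_sum_def
  proof (rule sum.reindex_bij_witness[where j = "\<lambda>p. g \<circ> p" and i = "\<lambda>p. ?h \<circ> p"])
    fix p assume p: "p \<in> {p. p permutes {1..n}}"
    show "?h \<circ> (g \<circ> p) = p" using gh by (simp add: comp_assoc[symmetric])
    show "g \<circ> p \<in> {p. p permutes {1..n}}" using p g permutes_compose by blast
    have sg: "sign (g \<circ> p) = sign g * sign p"
      using p perm by (intro sign_compose) (auto simp: permutation_permutes)
    have "tabloid (two_col n) (g \<circ> p \<circ> t) = T \<longleftrightarrow> tabloid (two_col n) (p \<circ> t) = map ((`) ?h) T"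
      using map_gh tabloid_comp[of "two_col n" g "p \<circ> t"] by (metis comp_assoc)
    moreover have "?h ` (g \<circ> p) ` {t (0, 1), t (1, 1)} = p ` {t (0, 1), t (1, 1)}"
      using gh by (metis comp_assoc id_comp image_comp)
    moreover have "complex_of_int (sign g) * complex_of_int (sign g) = 1"
      by (metis of_int_1 of_int_mult sign_idempotent)
    ultimately show "(if tabloid (two_col n) (g \<circ> p \<circ> t) = T then of_int (sign (g \<circ> p)) *
          (of_int (sign g) * f (?h ` (g \<circ> p) ` {t (0, 1), t (1, 1)})) else 0) =
        (if tabloid (two_col n) (p \<circ> t) = map ((`) ?h) T
          then of_int (sign p) * f (p ` {t (0, 1), t (1, 1)}) else 0)"
      unfolding sg by (simp add: algebra_simps)
  next
    fix p assume "p \<in> {p. p permutes {1..n}}"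
    thus "?h \<circ> p \<in> {p. p permutes {1..n}}" using h permutes_compose by blast
    show "g \<circ> (?h \<circ> p) = p" using gh by (simp add: comp_assoc[symmetric])
  qed
qed

section \<open>The Specht module as the image of the functions on pairs\<close>

text \<open>Tableaux take arbitrary values off the diagram, so a tableau can be matched with some
  \<open>q \<circ> t\<close> on the diagram only.\<close>

lemma polytabloid_cong:
  assumes "\<And>x. x \<in> young_diagram \<mu> \<Longrightarrow> t x = t' x"
  shows "polytabloid \<mu> t = polytabloid \<mu> t'"
proof -
  have "tableau_row \<mu> (p \<circ> t) i = tableau_row \<mu> (p \<circ> t') i" for p i
    unfolding tableau_row_def using assms by (metis comp_apply)
  hence "tableau_row \<mu> (p \<circ> t) = tableau_row \<mu> (p \<circ> t')" for p by blast
  moreover have "tableau_column \<mu> t j = tableau_column \<mu> t' j" for j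
    unfolding tableau_column_def using assms by metis
  ultimately show ?thesis unfolding polytabloid_def column_stabilizer_def tabloid_def by simp
qed

text \<open>The first column is the complement of the second, so stabilizing the columns of
  \<open>q \<circ> t\<close> means stabilizing its second column as a set. Replacing
  \<open>p\<close> by \<open>p \<circ> q\<close> turns this into the condition that \<open>p\<close>
  and \<open>q\<close> send the second column of \<open>t\<close> to the same pair.\<close>

lemma polytabloid_two_col:
  assumes n: "n \<ge> 4" and t: "bij_betw t (young_diagram (two_col n)) {1..n}"
    and q: "q permutes {1..n}"
  shows "polytabloid (two_col n) (q \<circ> t) =
    (\<lambda>T. of_int (sign q) *
       signed_tabloid_sum n t (\<lambda>Q. of_bool (Q = q ` {t (0, 1), t (1, 1)})) T)"
proof
  fix T
  let ?C = "{t (0, 1), t (1, 1)}" and ?h = "inv' q"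
  let ?S = "{p. p permutes {1..n} \<and> p ` q ` ?C = q ` ?C}"
  note h = permutes_inv[OF q]
  have qh: "q \<circ> ?h = id" "?h \<circ> q = id" using permutes_inv_o[OF q] by auto
  have col0: "tableau_column (two_col n) t 0 = {1..n} - ?C"
  proof -
    have "t ` ({..<n - 2} \<times> {0} \<union> {(0, 1), (1, 1)}) = {1..n}"
      using t unfolding bij_betw_def young_diagram_two_col[OF n] by blast
    moreover have "inj_on t ({..<n - 2} \<times> {0} \<union> {(0, 1), (1, 1)})"
      using t unfolding bij_betw_def young_diagram_two_col[OF n] by blast
    from inj_on_image_Int[OF this Un_upper1 Un_upper2]
    have "t ` ({..<n - 2} \<times> {0}) \<inter> t ` {(0, 1), (1, 1)} = {}"
      by (rule trans[OF sym]) auto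
    ultimately have "t ` ({..<n - 2} \<times> {0}) = {1..n} - t ` {(0, 1), (1, 1)}"
      unfolding image_Un by blast
    thus ?thesis unfolding tableau_column_two_col[OF n] by simp
  qed
  have diff: "p ` ({1..n} - A) = {1..n} - p ` A" if "p permutes {1..n}" for p A
    using permutes_image[OF that] permutes_inj[OF that] by (simp add: image_set_diff)
  have cs: "column_stabilizer (two_col n) (q \<circ> t) = ?S"
  proof -
    have eq: "(\<forall>j. p ` q ` tableau_column (two_col n) t j = q ` tableau_column (two_col n) t j) \<longleftrightarrow>
        p ` q ` ?C = q ` ?C" if p: "p permutes {1..n}" for p
    proof
      assume "\<forall>j. p ` q ` tableau_column (two_col n) t j = q ` tableau_column (two_col n) t j"
      from this[rule_format, of 1] show "p ` q ` ?C = q ` ?C"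
        unfolding tableau_column_two_col[OF n] by simp
    next
      assume e: "p ` q ` ?C = q ` ?C"
      have "p ` q ` tableau_column (two_col n) t 0 = q ` tableau_column (two_col n) t 0"
        unfolding col0 diff[OF q] diff[OF p] e by (rule refl)
      moreover have "p ` q ` tableau_column (two_col n) t j = q ` tableau_column (two_col n) t j"
        if "j > 0" for j
      proof -
        have "tableau_column (two_col n) t j \<in> {?C, {}}"
          using that unfolding tableau_column_two_col[OF n] by simp
        thus ?thesis using e by (metis image_empty insertE singletonD)
      qed
      ultimately show "\<forall>j. p ` q ` tableau_column (two_col n) t j = q ` tableau_column (two_col n) t j"
        by (metis gr0I)
    qed
    show ?thesis
      unfolding column_stabilizer_def sym_group_carrier sum_list_two_col[OF n] tableau_column_comp
      by (intro Collect_cong conj_cong refl eq)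
  qed
  have finP: "finite {p. p permutes {1..n}}" by (rule finite_permutations) simp
  have perm: "permutation p" if "p permutes {1..n}" for p using that by (auto simp: permutation_permutes)
  have sq: "complex_of_int (sign q) * complex_of_int (sign q) = 1"
    by (metis of_int_1 of_int_mult sign_idempotent)
  have "polytabloid (two_col n) (q \<circ> t) T =
      (\<Sum>p\<in>?S. if tabloid (two_col n) (p \<circ> q \<circ> t) = T then of_int (sign p) else 0)"
    unfolding polytabloid_def cs by (simp add: comp_assoc)
  also have "\<dots> = (\<Sum>p | p permutes {1..n} \<and> p ` ?C = q ` ?C.
      if tabloid (two_col n) (p \<circ> t) = T then of_int (sign q) * of_int (sign p) else 0)"
  proof (rule sum.reindex_bij_witness[where j = "\<lambda>p. p \<circ> q" and i = "\<lambda>p. p \<circ> ?h"])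
    fix p assume p: "p \<in> ?S"
    show "p \<circ> q \<circ> ?h = p" using qh by (simp add: comp_assoc)
    show "p \<circ> q \<in> {p. p permutes {1..n} \<and> p ` ?C = q ` ?C}"
      using p permutes_compose[OF q] by (auto simp: image_comp)
    have "sign (p \<circ> q) = sign p * sign q" using p perm q by (intro sign_compose) auto
    thus "(if tabloid (two_col n) (p \<circ> q \<circ> t) = T
        then complex_of_int (sign q) * of_int (sign (p \<circ> q)) else 0) =
      (if tabloid (two_col n) (p \<circ> q \<circ> t) = T then of_int (sign p) else 0)"
      using sq by (simp add: algebra_simps)
  next
    fix p assume p: "p \<in> {p. p permutes {1..n} \<and> p ` ?C = q ` ?C}"
    show phq: "p \<circ> ?h \<circ> q = p" using qh by (simp add: comp_assoc)
    have "(p \<circ> ?h) ` q ` ?C = q ` ?C" unfolding image_comp phq using p by simp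
    thus "p \<circ> ?h \<in> ?S" using p permutes_compose[OF h] by blast
  qed
  also have "\<dots> = (\<Sum>p\<in>{p. p permutes {1..n}}. if p ` ?C = q ` ?C then
      (if tabloid (two_col n) (p \<circ> t) = T then of_int (sign q) * of_int (sign p) else 0) else 0)"
    by (subst sum.inter_filter[OF finP, symmetric]) simp
  also have "\<dots> = of_int (sign q) * signed_tabloid_sum n t (\<lambda>Q. of_bool (Q = q ` ?C)) T"
    unfolding signed_tabloid_sum_def sum_distrib_left by (intro sum.cong) auto
  finally show "polytabloid (two_col n) (q \<circ> t) T =
    of_int (sign q) * signed_tabloid_sum n t (\<lambda>Q. of_bool (Q = q ` ?C)) T" .
qed

text \<open>By the previous lemma the polytabloids are, up to sign, the images of the indicators of
  single pairs, and these images span the range.\<close>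

lemma specht_two_col:
  assumes n: "n \<ge> 4" and t: "bij_betw t (young_diagram (two_col n)) {1..n}"
  shows "specht (two_col n) = range (signed_tabloid_sum n t)"
proof
  let ?C = "{t (0, 1), t (1, 1)}" and ?D = "young_diagram (two_col n)"
  have sub: "cfun.subspace (range (signed_tabloid_sum n t))"
    unfolding cfun.subspace_def
    using signed_tabloid_sum_0 signed_tabloid_sum_add signed_tabloid_sum_scale
    by (auto simp: image_iff) metis+
  show "specht (two_col n) \<subseteq> range (signed_tabloid_sum n t)"
    unfolding specht_def
  proof (rule cfun.span_minimal[OF _ sub], rule image_subsetI)
    fix t' assume "t' \<in> young_tableaux (two_col n)"
    hence t': "bij_betw t' ?D {1..n}" unfolding young_tableaux_def sum_list_two_col[OF n] by simp
    \<comment> \<open>The permutation carrying \<open>t\<close> to \<open>t'\<close>, extended by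
      the identity outside \<open>{1..n}\<close>.\<close>
    define q where "q = (\<lambda>x. if x \<in> {1..n} then t' (inv_into ?D t x) else x)"
    have "bij_betw (t' \<circ> inv_into ?D t) {1..n} {1..n}"
      using bij_betw_trans[OF bij_betw_inv_into[OF t] t'] .
    hence "bij_betw q {1..n} {1..n}" by (rule bij_betw_cong[THEN iffD1, rotated]) (simp add: q_def)
    hence q: "q permutes {1..n}" by (rule bij_imp_permutes) (auto simp: q_def)
    have "polytabloid (two_col n) t' = polytabloid (two_col n) (q \<circ> t)"
    proof (rule polytabloid_cong)
      fix x assume x: "x \<in> ?D"
      show "t' x = (q \<circ> t) x"
        using bij_betw_apply[OF t x] bij_betw_inv_into_left[OF t x] by (simp add: q_def)
    qed
    also have "\<dots> = signed_tabloid_sum n t (\<lambda>Q. of_int (sign q) * of_bool (Q = q ` ?C))"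
      unfolding polytabloid_two_col[OF n t q] signed_tabloid_sum_scale by (rule refl)
    finally show "polytabloid (two_col n) t' \<in> range (signed_tabloid_sum n t)" by simp
  qed
  show "range (signed_tabloid_sum n t) \<subseteq> specht (two_col n)"
  proof
    fix v assume "v \<in> range (signed_tabloid_sum n t)"
    then obtain f where v: "v = signed_tabloid_sum n t f" by blast
    have ind: "signed_tabloid_sum n t (\<lambda>Q. of_bool (Q = R)) \<in> specht (two_col n)" for R
    proof (cases "\<exists>q. q permutes {1..n} \<and> R = q ` ?C")
      case True
      then obtain q where q: "q permutes {1..n}" "R = q ` ?C" by blast
      have "q \<circ> t \<in> young_tableaux (two_col n)"
        unfolding young_tableaux_def sum_list_two_col[OF n]
        using bij_betw_trans[OF t permutes_imp_bij[OF q(1)]] by simp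
      hence "(\<lambda>T. of_int (sign q) * polytabloid (two_col n) (q \<circ> t) T) \<in> specht (two_col n)"
        unfolding specht_def by (intro cfun.span_scale cfun.span_base) simp
      moreover have "complex_of_int (sign q) * (complex_of_int (sign q) * z) = z" for z
        by (metis of_int_1 of_int_mult sign_idempotent mult.assoc mult_1)
      ultimately show ?thesis unfolding polytabloid_two_col[OF n t q(1)] q(2) by simp
    next
      \<comment> \<open>If \<open>R\<close> is not an image of the second column, no summand
        survives.\<close>
      case False
      hence "signed_tabloid_sum n t (\<lambda>Q. of_bool (Q = R)) = 0"
        unfolding signed_tabloid_sum_def
        by (intro ext, simp only: zero_fun_apply, intro sum.neutral) auto
      thus ?thesis unfolding specht_def using cfun.span_zero by metis
    qed
    \<comment> \<open>Only subsets of \<open>{1..n}\<close> are ever evaluated, so \<open>f\<close>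
      may be replaced by a finite combination of indicators.\<close>
    have "v = signed_tabloid_sum n t (\<lambda>Q. \<Sum>R\<in>Pow {1..n}. f R * of_bool (Q = R))"
      unfolding v
    proof (rule signed_tabloid_sum_cong[OF t n])
      fix Q :: "nat set" assume "Q \<subseteq> {1..n}"
      have "(\<Sum>R\<in>Pow {1..n}. f R * of_bool (Q = R)) = (\<Sum>R\<in>Pow {1..n}. if Q = R then f R else 0)"
        by (intro sum.cong) auto
      thus "f Q = (\<Sum>R\<in>Pow {1..n}. f R * of_bool (Q = R))" using \<open>Q \<subseteq> {1..n}\<close> by simp
    qed
    also have "\<dots> = (\<Sum>R\<in>Pow {1..n}. (\<lambda>T. f R * signed_tabloid_sum n t (\<lambda>Q. of_bool (Q = R)) T))"
      by (subst signed_tabloid_sum_sum) (simp_all add: signed_tabloid_sum_scale)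
    also have "\<dots> \<in> specht (two_col n)"
      using ind unfolding specht_def by (intro cfun.span_sum cfun.span_scale)
    finally show "v \<in> specht (two_col n)" .
  qed
qed

section \<open>Coefficients of signed tabloid sums as defects\<close>

text \<open>The permutations contributing to this coefficient are \<open>q\<close> times the row
  stabilizer of \<open>t\<close>. With rows \<open>{a, c}\<close> and \<open>{b, d}\<close> this is
  the four-group \<open>?R\<close> generated by two transpositions. Its elements have signs 1, -1,
  -1, 1 and send the second column \<open>{c, d}\<close> to the four pairs of the defect.\<close>

lemma signed_tabloid_sum_tabloid:
  assumes n: "n \<ge> 4" and t: "bij_betw t (young_diagram (two_col n)) {1..n}"
    and q: "q permutes {1..n}"
  shows "signed_tabloid_sum n t f (tabloid (two_col n) (q \<circ> t)) =
    of_int (sign q) *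
      quad_defect f (q (t (0, 0))) (q (t (0, 1))) (q (t (1, 0))) (q (t (1, 1)))"
proof -
  define a b c d where "a = t (0, 0)" and "b = t (1, 0)" and "c = t (0, 1)" and "d = t (1, 1)"
  note D = young_diagram_two_col[OF n]
  note neq = inj_on_eq_iff[OF bij_betw_imp_inj_on[OF t]]
  have inD: "(0, 0) \<in> young_diagram (two_col n)" "(1, 0) \<in> young_diagram (two_col n)"
    "(0, 1) \<in> young_diagram (two_col n)" "(1, 1) \<in> young_diagram (two_col n)"
    using n by (auto simp: D)
  have dist: "distinct [a, b, c, d]"
    unfolding a_def b_def c_def d_def using inD by (simp add: neq)
  have X: "a \<in> {1..n}" "b \<in> {1..n}" "c \<in> {1..n}" "d \<in> {1..n}"
    unfolding a_def b_def c_def d_def using inD by (blast intro: bij_betw_apply[OF t])+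
  let ?ac = "transpose a c" and ?bd = "transpose b d"
  have ac: "?ac permutes {1..n}" and bd: "?bd permutes {1..n}"
    using X by (auto intro: permutes_swap_id)
  let ?R = "{id, ?ac, ?bd, ?ac \<circ> ?bd}"
  have surj: "\<exists>x\<in>young_diagram (two_col n). t x = y" if "y \<in> {1..n}" for y
    using t that unfolding bij_betw_def by (metis imageE)
  have tab: "tabloid (two_col n) (p \<circ> t) = tabloid (two_col n) (p' \<circ> t) \<longleftrightarrow>
      p ` {a, c} = p' ` {a, c} \<and> p ` {b, d} = p' ` {b, d} \<and>
      (\<forall>i. 2 \<le> i \<and> i < n - 2 \<longrightarrow> p (t (i, 0)) = p' (t (i, 0)))" for p p'
  proof -
    have "tabloid (two_col n) (p \<circ> t) = tabloid (two_col n) (p' \<circ> t) \<longleftrightarrow>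
       (\<forall>i<n - 2. tableau_row (two_col n) (p \<circ> t) i = tableau_row (two_col n) (p' \<circ> t) i)"
      using n by (auto simp: tabloid_def list_eq_iff_nth_eq length_two_col)
    also have "\<dots> \<longleftrightarrow> (\<forall>i<n - 2. if i < 2 then {p (t (i, 0)), p (t (i, 1))} =
        {p' (t (i, 0)), p' (t (i, 1))} else p (t (i, 0)) = p' (t (i, 0)))"
      using n by (auto simp: tableau_row_two_col)
    also have "\<dots> \<longleftrightarrow> p ` {a, c} = p' ` {a, c} \<and> p ` {b, d} = p' ` {b, d} \<and>
      (\<forall>i. 2 \<le> i \<and> i < n - 2 \<longrightarrow> p (t (i, 0)) = p' (t (i, 0)))"
    proof -
      have "(\<forall>i<n - 2. P i) \<longleftrightarrow> P 0 \<and> P 1 \<and> (\<forall>i. 2 \<le> i \<and> i < n - 2 \<longrightarrow> P i)" for P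
      proof -
        have "0 < n - 2" "1 < n - 2" "i = 0 \<or> i = 1 \<or> 2 \<le> i" for i :: nat using n by linarith+
        thus ?thesis by metis
      qed
      from this[of "\<lambda>i. if i < 2 then {p (t (i, 0)), p (t (i, 1))} =
        {p' (t (i, 0)), p' (t (i, 1))} else p (t (i, 0)) = p' (t (i, 0))"]
      show ?thesis unfolding a_def b_def c_def d_def by auto
    qed
    finally show ?thesis .
  qed
  have stab: "{p. p permutes {1..n} \<and> tabloid (two_col n) (p \<circ> t) = tabloid (two_col n) (id \<circ> t)} = ?R"
  proof (intro equalityI subsetI)
    fix p assume "p \<in> {p. p permutes {1..n} \<and> tabloid (two_col n) (p \<circ> t) = tabloid (two_col n) (id \<circ> t)}"
    hence p: "p permutes {1..n}" and "p ` {a, c} = id ` {a, c}" "p ` {b, d} = id ` {b, d}"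
      and rest: "\<And>i. 2 \<le> i \<Longrightarrow> i < n - 2 \<Longrightarrow> p (t (i, 0)) = id (t (i, 0))"
      unfolding tab by auto
    hence pac: "p a = a \<and> p c = c \<or> p a = c \<and> p c = a" and pbd: "p b = b \<and> p d = d \<or> p b = d \<and> p d = b"
      by (auto simp: doubleton_eq_iff)
    have fixed: "p y = y" if "y \<notin> {a, b, c, d}" for y
    proof (cases "y \<in> {1..n}")
      case True
      then obtain x where x: "x \<in> young_diagram (two_col n)" "t x = y" using surj by blast
      have "x \<notin> {(0, 0), (1, 0), (0, 1), (1, 1)}"
        using that x(2) unfolding a_def b_def c_def d_def by auto
      moreover from this x(1) obtain i where i: "x = (i, 0)" "i < n - 2" unfolding D by auto
      ultimately have "2 \<le> i" by (cases i; cases "i - 1") auto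
      thus ?thesis using rest[of i] i x(2) by simp
    qed (use permutes_not_in[OF p] in blast)
    from pac pbd consider "p a = a \<and> p c = c \<and> p b = b \<and> p d = d"
      | "p a = c \<and> p c = a \<and> p b = b \<and> p d = d" | "p a = a \<and> p c = c \<and> p b = d \<and> p d = b"
      | "p a = c \<and> p c = a \<and> p b = d \<and> p d = b" by blast
    hence "p = id \<or> p = ?ac \<or> p = ?bd \<or> p = ?ac \<circ> ?bd"
    proof cases
      case 1
      hence "p = id" by (intro ext) (metis fixed id_apply insertE empty_iff)
      thus ?thesis by blast
    next
      case 2
      have "p y = ?ac y" for y
        using 2 fixed[of y] dist by (cases "y \<in> {a, b, c, d}") (auto simp: transpose_def)
      thus ?thesis by blast
    next
      case 3
      have "p y = ?bd y" for y
        using 3 fixed[of y] dist by (cases "y \<in> {a, b, c, d}") (auto simp: transpose_def)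
      thus ?thesis by blast
    next
      case 4
      have "p y = (?ac \<circ> ?bd) y" for y
        using 4 fixed[of y] dist by (cases "y \<in> {a, b, c, d}") (auto simp: transpose_def)
      thus ?thesis by blast
    qed
    thus "p \<in> ?R" by blast
  next
    fix p assume p: "p \<in> ?R"
    have "t (i, 0) \<notin> {a, b, c, d}" if "2 \<le> i" "i < n - 2" for i
    proof -
      have "(i, 0) \<in> young_diagram (two_col n)" using that by (simp add: D)
      thus ?thesis using that inD unfolding a_def b_def c_def d_def by (simp add: neq)
    qed
    moreover have "p permutes {1..n}" using p ac bd by (auto intro: permutes_compose permutes_id)
    moreover have "p y = y" if "y \<notin> {a, b, c, d}" for y using that p by (auto simp: transpose_def)
    moreover have "p ` {a, c} = {a, c}" "p ` {b, d} = {b, d}"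
      using p dist by (auto simp: transpose_def)
    ultimately show "p \<in> {p. p permutes {1..n} \<and> tabloid (two_col n) (p \<circ> t) = tabloid (two_col n) (id \<circ> t)}"
      unfolding tab by auto
  qed
  let ?h = "inv' q"
  have qh: "q \<circ> ?h = id" "?h \<circ> q = id" using permutes_inv_o[OF q] by auto
  have perm: "permutation p" if "p permutes {1..n}" for p
    using that by (auto simp: permutation_permutes)
  have finP: "finite {p. p permutes {1..n}}" by (rule finite_permutations) simp
  have "signed_tabloid_sum n t f (tabloid (two_col n) (q \<circ> t)) =
      (\<Sum>p | p permutes {1..n} \<and> tabloid (two_col n) (p \<circ> t) = tabloid (two_col n) (q \<circ> t).
        of_int (sign p) * f (p ` {c, d}))"
    unfolding signed_tabloid_sum_def c_def d_def
    by (subst sum.inter_filter[OF finP, symmetric]) simp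
  also have "\<dots> = (\<Sum>p\<in>?R. of_int (sign q) * (of_int (sign p) * f (q ` p ` {c, d})))"
    unfolding stab[symmetric]
  proof (rule sum.reindex_bij_witness[where j = "\<lambda>p. ?h \<circ> p" and i = "\<lambda>p. q \<circ> p"])
    fix p assume p: "p \<in> {p. p permutes {1..n} \<and>
      tabloid (two_col n) (p \<circ> t) = tabloid (two_col n) (q \<circ> t)}"
    show qhp: "q \<circ> (?h \<circ> p) = p" using qh by (simp add: comp_assoc[symmetric])
    have "tabloid (two_col n) (?h \<circ> p \<circ> t) = tabloid (two_col n) (?h \<circ> q \<circ> t)"
      using p by (simp add: comp_assoc tabloid_comp[of _ ?h])
    thus hp: "?h \<circ> p \<in> {p. p permutes {1..n} \<and> tabloid (two_col n) (p \<circ> t) = tabloid (two_col n) (id \<circ> t)}"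
      using p qh permutes_compose[OF _ permutes_inv[OF q]] by simp
    have "sign p = sign q * sign (?h \<circ> p)"
      using sign_compose[of q "?h \<circ> p"] qhp perm q hp by simp
    moreover have "q ` (?h \<circ> p) ` {c, d} = p ` {c, d}" using qhp by (metis image_comp)
    ultimately show "of_int (sign q) * (of_int (sign (?h \<circ> p)) * f (q ` (?h \<circ> p) ` {c, d})) =
      of_int (sign p) * f (p ` {c, d})" by simp
  next
    fix p assume p: "p \<in> {p. p permutes {1..n} \<and> tabloid (two_col n) (p \<circ> t) = tabloid (two_col n) (id \<circ> t)}"
    show "?h \<circ> (q \<circ> p) = p" using qh by (simp add: comp_assoc[symmetric])
    show "q \<circ> p \<in> {p. p permutes {1..n} \<and> tabloid (two_col n) (p \<circ> t) = tabloid (two_col n) (q \<circ> t)}"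
      using p permutes_compose[OF _ q] by (simp add: comp_assoc tabloid_comp[of _ q])
  qed
  also have "\<dots> = of_int (sign q) * quad_defect f (q a) (q c) (q b) (q d)"
  proof -
    have ne: "id \<noteq> ?ac" "id \<noteq> ?bd" "id \<noteq> ?ac \<circ> ?bd" "?ac \<noteq> ?bd" "?ac \<noteq> ?ac \<circ> ?bd" "?bd \<noteq> ?ac \<circ> ?bd"
      using dist by (auto simp: fun_eq_iff transpose_def)
    have sg: "sign ?ac = -1" "sign ?bd = -1" "sign (?ac \<circ> ?bd) = 1"
      using dist sign_compose[OF perm[OF ac] perm[OF bd]] by (simp_all add: sign_swap_id)
    have "?ac c = a" "?ac d = d" "?ac b = b" "?bd c = c" "?bd d = b"
      using dist by (auto intro: transpose_apply_other)
    hence im: "?ac ` {c, d} = {a, d}" "?bd ` {c, d} = {c, b}" "(?ac \<circ> ?bd) ` {c, d} = {a, b}"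
      by (simp_all only: image_insert image_empty comp_apply)
    have "(\<Sum>p\<in>?R. h p) = h id + h ?ac + h ?bd + h (?ac \<circ> ?bd)" for h :: "(nat \<Rightarrow> nat) \<Rightarrow> complex"
      using ne by (simp add: add.assoc)
    thus ?thesis unfolding quad_defect_def by (simp only: sg im) (simp add: algebra_simps)
  qed
  finally show ?thesis unfolding a_def b_def c_def d_def .
qed

text \<open>This makes the defect at any prescribed quadruple a coefficient of a signed tabloid
  sum.\<close>

lemma exists_tableau_with_corners:
  assumes n: "n \<ge> 4" and dist: "distinct [p, q, r, s]" and X: "{p, q, r, s} \<subseteq> {1..n}"
  obtains t where "bij_betw t (young_diagram (two_col n)) {1..n}"
    "t (0, 0) = p" "t (0, 1) = q" "t (1, 0) = r" "t (1, 1) = s"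
proof -
  let ?K = "{(0, 0), (0, 1), (1, 0), (1, 1)} :: (nat \<times> nat) set"
  let ?L = "{2..<n - 2} \<times> {0 :: nat}" and ?M = "{1..n} - {p, q, r, s}"
  have "card ?L = n - 4" by simp
  moreover have "card ?M = n - 4"
    using card_Diff_subset[OF _ X] dist by simp
  ultimately obtain t' where t': "bij_betw t' ?L ?M"
    using finite_same_card_bij[of ?L ?M] by auto
  define t where "t = t'((0, 0) := p, (0, 1) := q, (1, 0) := r, (1, 1) := s)"
  have vals: "t (0, 0) = p" "t (0, 1) = q" "t (1, 0) = r" "t (1, 1) = s"
    unfolding t_def by auto
  have "t x = t' x" if "x \<in> ?L" for x using that unfolding t_def by auto
  hence L: "bij_betw t ?L ?M" using bij_betw_cong[of ?L t t' ?M] t' by blast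
  have K: "bij_betw t ?K {p, q, r, s}"
    using dist vals by (auto simp: bij_betw_def inj_on_def)
  have "bij_betw t (?L \<union> ?K) (?M \<union> {p, q, r, s})" by (rule bij_betw_combine[OF L K]) blast
  moreover have "?L \<union> ?K = young_diagram (two_col n)"
    unfolding young_diagram_two_col[OF n] using n by fastforce
  moreover have "?M \<union> {p, q, r, s} = {1..n}" using X by blast
  ultimately show ?thesis using that[OF _ vals] by metis
qed

text \<open>A nonzero coefficient can only occur at the tabloid of some \<open>p \<circ> t\<close>,
  where it is up to sign the defect at the four corner entries.\<close>

lemma has_quad_defect_if_signed_tabloid_sum_neq_0:
  assumes n: "n \<ge> 4" and t: "bij_betw t (young_diagram (two_col n)) {1..n}"
    and ne: "signed_tabloid_sum n t F \<noteq> 0"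
  shows "has_quad_defect {1..n} F"
proof -
  obtain T where T: "signed_tabloid_sum n t F T \<noteq> 0" using ne by (auto simp: fun_eq_iff)
  have "\<exists>p. p permutes {1..n} \<and> tabloid (two_col n) (p \<circ> t) = T"
  proof (rule ccontr)
    assume "\<not> ?thesis"
    hence "signed_tabloid_sum n t F T = 0"
      unfolding signed_tabloid_sum_def by (intro sum.neutral) auto
    thus False using T by simp
  qed
  then obtain p where p: "p permutes {1..n}" "tabloid (two_col n) (p \<circ> t) = T" by blast
  have "bij_betw (p \<circ> t) (young_diagram (two_col n)) {1..n}"
    using bij_betw_trans[OF t permutes_imp_bij[OF p(1)]] .
  note pt = bij_betw_apply[OF this] inj_on_eq_iff[OF bij_betw_imp_inj_on[OF this]]
  have D: "(0, 0) \<in> young_diagram (two_col n)" "(0, 1) \<in> young_diagram (two_col n)"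
    "(1, 0) \<in> young_diagram (two_col n)" "(1, 1) \<in> young_diagram (two_col n)"
    unfolding young_diagram_two_col[OF n] using n by auto
  have "quad_defect F (p (t (0, 0))) (p (t (0, 1))) (p (t (1, 0))) (p (t (1, 1))) \<noteq> 0"
    using T signed_tabloid_sum_tabloid[OF n t p(1)] p(2) by simp
  moreover have "{p (t (0, 0)), p (t (0, 1)), p (t (1, 0)), p (t (1, 1))} \<subseteq> {1..n}"
    using pt(1)[OF D(1)] pt(1)[OF D(2)] pt(1)[OF D(3)] pt(1)[OF D(4)] by simp
  moreover have "distinct [p (t (0, 0)), p (t (0, 1)), p (t (1, 0)), p (t (1, 1))]"
    using pt(2)[OF D(1) D(2)] pt(2)[OF D(1) D(3)] pt(2)[OF D(1) D(4)]
      pt(2)[OF D(2) D(3)] pt(2)[OF D(2) D(4)] pt(2)[OF D(3) D(4)] by simp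
  ultimately show ?thesis unfolding has_quad_defect_def by blast
qed

section \<open>Fixed vectors and the parity criterion\<close>

text \<open>A preimage \<open>f\<close> of a fixed vector \<open>v\<close> may differ from its
  translates by an element of the kernel. Summing the translates under the twisted action
  \<open>S\<close> over a full period repairs this, and the image becomes a nonzero multiple of
  \<open>v\<close>. Conversely, a tableau with the given quadruple in its corners shows that the
  image of \<open>F\<close> is nonzero.\<close>

lemma specht_two_col_fixed_vector_iff:
  assumes n: "n \<ge> 4" and g: "g permutes {1..n}"
  shows "(\<exists>v\<in>specht (two_col n). v \<noteq> 0 \<and> tabloid_rep g v = v) \<longleftrightarrow>
    (\<exists>F. (\<forall>Q. F (g ` Q) = of_int (sign g) * F Q) \<and> has_quad_defect {1..n} F)"
proof
  define S where "S = (\<lambda>(h :: nat set \<Rightarrow> complex) Q. of_int (sign g) * h (inv' g ` Q))"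
  have gh: "g \<circ> inv' g = id" "inv' g \<circ> g = id" using permutes_inv_o[OF g] by auto
  have sg: "complex_of_int (sign g) * complex_of_int (sign g) = 1"
    by (metis of_int_1 of_int_mult sign_idempotent)
  {
    assume "\<exists>v\<in>specht (two_col n). v \<noteq> 0 \<and> tabloid_rep g v = v"
    then obtain v where v: "v \<in> specht (two_col n)" "v \<noteq> 0" "tabloid_rep g v = v" by blast
    have "distinct [1, 2, 3, 4 :: nat]" "{1, 2, 3, 4} \<subseteq> {1..n}" using n by auto
    then obtain t where t: "bij_betw t (young_diagram (two_col n)) {1..n}"
      using exists_tableau_with_corners[OF n] by metis
    obtain f where f: "v = signed_tabloid_sum n t f" using v(1) specht_two_col[OF n t] by blast
    have Sv: "signed_tabloid_sum n t ((S ^^ i) f) = v" for i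
    proof (induction i)
      case (Suc i)
      have "signed_tabloid_sum n t ((S ^^ Suc i) f) =
          tabloid_rep g (signed_tabloid_sum n t ((S ^^ i) f))"
        unfolding tabloid_rep_signed_tabloid_sum[OF g] by (simp add: S_def)
      thus ?case unfolding Suc v(3) .
    qed (simp add: f)
    have Sf: "(S ^^ i) f Q = of_int (sign g) ^ i * f ((inv' g ^^ i) ` Q)" for i Q
    proof (induction i arbitrary: Q)
      case (Suc i)
      have "(inv' g ^^ i) ` inv' g ` Q = (inv' g ^^ Suc i) ` Q"
        unfolding funpow_Suc_right image_comp by (rule refl)
      thus ?case using Suc[of "inv' g ` Q"] by (simp add: S_def)
    qed simp
    have "permutation (inv' g)" using permutes_inv[OF g] by (auto simp: permutation_permutes)
    then obtain N where N: "inv' g ^^ N = id" "N > 0" using permutation_is_nilpotent by blast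
    \<comment> \<open>The factor 2 makes the sign factor of \<open>S ^^ m\<close> equal to 1 as
      well.\<close>
    define m where "m = 2 * N"
    have "inv' g ^^ m = id" unfolding m_def mult_2 funpow_add N(1) by simp
    moreover have "complex_of_int (sign g) ^ m = 1"
      unfolding m_def power_mult power2_eq_square sg by simp
    ultimately have Sm: "(S ^^ m) f = f" by (simp add: fun_eq_iff Sf)
    define F where "F = (\<lambda>Q. \<Sum>i<m. (S ^^ i) f Q)"
    have "F (g ` Q) = of_int (sign g) * F Q" for Q
    proof -
      have "(S ^^ Suc i) f (g ` Q) = of_int (sign g) * (S ^^ i) f Q" for i
        using gh(2) by (simp add: S_def image_comp)
      hence "of_int (sign g) * F Q = (\<Sum>i<m. (S ^^ Suc i) f (g ` Q))"
        unfolding F_def sum_distrib_left by (intro sum.cong) auto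
      \<comment> \<open>The index shift leaves the boundary terms of index 0 and \<open>m\<close>,
        which cancel by periodicity.\<close>
      also have "\<dots> = (\<Sum>i<Suc m. (S ^^ i) f (g ` Q)) - f (g ` Q)"
        by (subst sum.lessThan_Suc_shift) simp
      also have "\<dots> = F (g ` Q)" unfolding F_def using Sm by simp
      finally show ?thesis by simp
    qed
    moreover have "has_quad_defect {1..n} F"
    proof (rule has_quad_defect_if_signed_tabloid_sum_neq_0[OF n t])
      have "signed_tabloid_sum n t F = (\<Sum>i<m. v)"
        unfolding F_def using signed_tabloid_sum_sum[of "{..<m}" n t "\<lambda>i. (S ^^ i) f"]
        by (simp only: Sv finite_lessThan)
      hence FT: "signed_tabloid_sum n t F T = of_nat m * v T" for T
      proof -
        have "(\<Sum>i<k. v) T = of_nat k * v T" for k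
          by (induction k) (simp_all add: algebra_simps)
        thus ?thesis using \<open>signed_tabloid_sum n t F = (\<Sum>i<m. v)\<close> by simp
      qed
      obtain T where "v T \<noteq> 0" using v(2) by (auto simp: fun_eq_iff)
      hence "signed_tabloid_sum n t F T \<noteq> 0" using FT N(2) by (simp add: m_def)
      thus "signed_tabloid_sum n t F \<noteq> 0" by (metis zero_fun_apply)
    qed
    ultimately show "\<exists>F. (\<forall>Q. F (g ` Q) = of_int (sign g) * F Q) \<and> has_quad_defect {1..n} F"
      by blast
  next
    assume "\<exists>F. (\<forall>Q. F (g ` Q) = of_int (sign g) * F Q) \<and> has_quad_defect {1..n} F"
    then obtain F p q r s where F: "\<And>Q. F (g ` Q) = of_int (sign g) * F Q"
      and pqrs: "distinct [p, q, r, s]" "{p, q, r, s} \<subseteq> {1..n}" "quad_defect F p q r s \<noteq> 0"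
      unfolding has_quad_defect_def by blast
    obtain t where t: "bij_betw t (young_diagram (two_col n)) {1..n}"
      and vals: "t (0, 0) = p" "t (0, 1) = q" "t (1, 0) = r" "t (1, 1) = s"
      using exists_tableau_with_corners[OF n pqrs(1,2)] by blast
    have "of_int (sign g) * F (inv' g ` Q) = F Q" for Q
      using F[of "inv' g ` Q"] gh(1) by (simp add: image_comp)
    hence "tabloid_rep g (signed_tabloid_sum n t F) = signed_tabloid_sum n t F"
      unfolding tabloid_rep_signed_tabloid_sum[OF g] by simp
    moreover have "signed_tabloid_sum n t F (tabloid (two_col n) (id \<circ> t)) \<noteq> 0"
      unfolding signed_tabloid_sum_tabloid[OF n t permutes_id] using pqrs(3) vals by simp
    hence "signed_tabloid_sum n t F \<noteq> 0" by (metis zero_fun_apply)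
    moreover have "signed_tabloid_sum n t F \<in> specht (two_col n)"
      unfolding specht_two_col[OF n t] by blast
    ultimately show "\<exists>v\<in>specht (two_col n). v \<noteq> 0 \<and> tabloid_rep g v = v" by blast
  }
qed

theorem theorem1p4:
  fixes n :: nat
  assumes "n \<ge> 5"
  shows "unisingular (sym_group n) (specht ([2, 2] @ replicate (n - 4) 1)) tabloid_rep
           \<longleftrightarrow> even n"
proof -
  have n: "n \<ge> 4" using assms by simp
  have uni: "unisingular (sym_group n) (specht (two_col n)) tabloid_rep \<longleftrightarrow>
    (\<forall>g. g permutes {1..n} \<longrightarrow>
      (\<exists>F. (\<forall>Q. F (g ` Q) = of_int (sign g) * F Q) \<and> has_quad_defect {1..n} F))"
    unfolding unisingular_iff_eigenvalue_1[OF specht_representation[OF sum_list_two_col[OF n]]]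
    using specht_two_col_fixed_vector_iff[OF n] by (simp add: sym_group_carrier Ball_def)
  have "unisingular (sym_group n) (specht (two_col n)) tabloid_rep \<longleftrightarrow> even n"
  proof (cases "even n")
    case True
    hence "n \<ge> 6" using assms by (cases "n = 5") auto
    hence "\<exists>F. (\<forall>Q. F (g ` Q) = of_int (sign g) * F Q) \<and> has_quad_defect {1..n} F"
      if "g permutes {1..n}" for g
      using exists_semi_invariant_quad_defect[OF that] True by (metis card_atLeastAtMost
          diff_Suc_1 finite_atLeastAtMost)
    thus ?thesis using True uni by blast
  next
    case False
    show ?thesis
      using exists_permutation_without_quad_defect[OF False assms] uni False by metis
  qed
  thus ?thesis unfolding two_col_def .
qed

end
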